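(* Let $M=\mathbb{R}/\mathbb{Z}$ be the circle and let $f_0:M\to M$ be a $C^2$ local diffeomorphism having a unique saddle-node fixed point, denoted $0$, i.e. $f_0(0)=0$, $f_0'(0)=1$ and $f_0''(0)>0$. Let $W_0$ be the connected component containing $0$ of the basin $B(\{0\})=\{x\in M: f_0^k(x)\to 0 \text{ as } k\to\infty\}$, and assume $|f_0'(x)|>1$ for all $x\in M\setminus W_0$. Then every $f_0$-invariant Borel probability measure $\mu$ satisfying the Entropy Formula $h_\mu(f_0)=\int\log|f_0'|\,d\mu$ coincides with the Dirac mass $\delta_0$ at $0$.
   Context: $h_\mu(f_0)$ denotes the Kolmogorov–Sinai metric entropy of $f_0$ with respect to $\mu$. *)

theory Defs
  imports "HOL-Probability.Probability"
begin

text \<open>The circle M = R/Z is represented by the fundamental domain {0..<1};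
  a circle map is given by a lift F : real => real, and the induced map is frac o F.\<close>

definition circle_space :: "real set" where
  "circle_space = {0..<1}"

definition circle_borel :: "real measure" where
  "circle_borel = restrict_space borel circle_space"

definition circle_norm :: "real \<Rightarrow> real" where
  "circle_norm t = min (frac t) (1 - frac t)"

definition fin_partition :: "'a measure \<Rightarrow> 'a set set \<Rightarrow> bool" where
  "fin_partition M P \<longleftrightarrow> finite P \<and> P \<subseteq> sets M \<and> \<Union>P = space M
     \<and> disjoint P \<and> {} \<notin> P"

definition join_partition :: "'a measure \<Rightarrow> ('a \<Rightarrow> 'a) \<Rightarrow> 'a set set \<Rightarrow> nat \<Rightarrow> 'a set set" where
  "join_partition M T P n = {A. A \<noteq> {} \<and> (\<exists>a. (\<forall>i<n. a i \<in> P) \<and>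
      A = space M \<inter> (\<Inter>i\<in>{..<n}. (T ^^ i) -` a i))}"

definition partition_entropy :: "'a measure \<Rightarrow> 'a set set \<Rightarrow> real" where
  "partition_entropy M P = - (\<Sum>A\<in>P. measure M A * ln (measure M A))"

definition entropy_wrt_partition :: "'a measure \<Rightarrow> ('a \<Rightarrow> 'a) \<Rightarrow> 'a set set \<Rightarrow> real" where
  "entropy_wrt_partition M T P =
     lim (\<lambda>n. partition_entropy M (join_partition M T P (Suc n)) / real (Suc n))"

definition ks_entropy :: "'a measure \<Rightarrow> ('a \<Rightarrow> 'a) \<Rightarrow> ereal" where
  "ks_entropy M T = (SUP P \<in> {P. fin_partition M P}. ereal (entropy_wrt_partition M T P))"

definition invariant_measure :: "'a measure \<Rightarrow> ('a \<Rightarrow> 'a) \<Rightarrow> bool" where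
  "invariant_measure M T \<longleftrightarrow> T \<in> M \<rightarrow>\<^sub>M M \<and>
     (\<forall>A\<in>sets M. emeasure M (T -` A \<inter> space M) = emeasure M A)"

end

theory Submission
  imports Defs
begin

text \<open>
  Normalise the lift so that \<open>F 0 = 0\<close>, let \<open>d\<close> be the degree, \<open>a\<close> the largest fixed point of \<open>F\<close> in
  \<open>[-1, 0)\<close> and \<open>b = a + 1\<close>.  On \<open>(b, 1)\<close> the circle map pushes points towards \<open>1\<close>, so an invariant
  measure lives on \<open>[0, b]\<close>.  This interval meets the immediate basin only in \<open>0\<close>, hence \<open>F' > 1\<close> on
  \<open>(0, b]\<close>, and \<open>F\<close> maps \<open>[0, b]\<close> onto \<open>[0, b + d - 1]\<close>: a full-branch Cantor map with gaps.

  Gibbs' inequality, applied to a partition refined by the coding, with weights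
  \<open>|I\<^sub>w| exp (\<kappa> N w)\<close>, where \<open>I\<^sub>w\<close> is the cylinder of the word \<open>w\<close> and \<open>N w\<close> the number of its nonzero
  letters, gives \<open>h \<le> \<integral> ln F' - \<kappa> \<mu>(Y)\<close>, where \<open>Y\<close> is the complement of the branch of the neutral
  point.  Two facts make this work.  Distortion along a word of length \<open>n\<close> is \<open>o(n)\<close>, because cylinders
  shrink uniformly.  It is bounded for words that end in a nonzero letter, so these lose a fixed
  proportion of length to a gap; this pays for the factor \<open>exp \<kappa>\<close> and keeps the sum of the weights
  bounded.  The entropy formula therefore forces \<open>\<mu>(Y) = 0\<close>, and on the remaining branch the map
  moves every point except \<open>0\<close> to the right.
\<close>

section \<open>Entropy bounds from a coding\<close>

definition words :: "'a set \<Rightarrow> nat \<Rightarrow> 'a list set" where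
  "words S n = {w. set w \<subseteq> S \<and> length w = n}"

lemma finite_words [intro]: "finite S \<Longrightarrow> finite (words S n)"
  unfolding words_def by (rule finite_lists_length_eq)

lemma words_0 [simp]: "words S 0 = {[]}"
  by (auto simp: words_def)

lemma words_append:
  "words S (m + n) = (\<lambda>(u, v). u @ v) ` (words S m \<times> words S n)"
proof (intro equalityI subsetI)
  fix w assume "w \<in> words S (m + n)"
  then have "take m w \<in> words S m" "drop m w \<in> words S n"
    by (auto simp: words_def dest: in_set_takeD in_set_dropD)
  then show "w \<in> (\<lambda>(u, v). u @ v) ` (words S m \<times> words S n)"
    by (metis (no_types, lifting) SigmaI append_take_drop_id case_prod_conv image_eqI)
qed (auto simp: words_def)

lemma sum_words_append:
  "sum g (words S (m + n)) = (\<Sum>u\<in>words S m. \<Sum>v\<in>words S n. g (u @ v))"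
proof -
  have "inj_on (\<lambda>(u, v). u @ v) (words S m \<times> words S n)"
    by (auto simp: inj_on_def words_def)
  then show ?thesis
    by (simp add: words_append sum.reindex sum.cartesian_product case_prod_unfold)
qed

lemma words_1: "words S (Suc 0) = (\<lambda>a. [a]) ` S"
  by (auto simp: words_def length_Suc_conv)

lemma sum_words_1: "sum g (words S (Suc 0)) = (\<Sum>a\<in>S. g [a])"
  by (simp add: words_1 sum.reindex inj_on_def)

lemma sum_words_Suc:
  "sum g (words S (Suc n)) = (\<Sum>a\<in>S. \<Sum>w\<in>words S n. g (a # w))"
  using sum_words_append[of g S 1 n] by (simp add: sum_words_1)

lemma sum_words_snoc:
  "sum g (words S (Suc n)) = (\<Sum>w\<in>words S n. \<Sum>a\<in>S. g (w @ [a]))"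
  using sum_words_append[of g S n 1] by (simp add: sum_words_1)

section \<open>Gibbs' inequality and Fekete's lemma\<close>

text \<open>This is \<open>ln z \<le> z - 1\<close> at \<open>z = p i / (Z * q i)\<close>, weighted
  by \<open>q i\<close> and summed. The weights \<open>p\<close> need not be normalised: an upper
  bound \<open>Z\<close> for their mass costs only \<open>ln Z\<close>.\<close>

lemma gibbs_inequality:
  fixes p q :: "'i \<Rightarrow> real"
  assumes "finite I" and q: "\<And>i. i \<in> I \<Longrightarrow> q i \<ge> 0" "sum q I = 1"
    and p: "\<And>i. i \<in> I \<Longrightarrow> p i \<ge> 0" "\<And>i. i \<in> I \<Longrightarrow> q i > 0 \<Longrightarrow> p i > 0"
    and Z: "sum p I \<le> Z"
  shows "(\<Sum>i\<in>I. - q i * ln (q i)) \<le> (\<Sum>i\<in>I. - q i * ln (p i)) + ln Z"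
proof -
  obtain i where "i \<in> I" "q i > 0"
    using q by (metis less_eq_real_def sum.neutral zero_neq_one)
  then have "sum p I > 0"
    using p by (meson assms(1) sum_pos2)
  then have Zpos: "Z > 0" using Z by linarith
  have "- q i * ln (q i) \<le> - q i * ln (p i) + q i * ln Z + (p i / Z - q i)" if "i \<in> I" for i
  proof (cases "q i = 0")
    case True
    then show ?thesis using p(1)[OF that] Zpos by simp
  next
    case False
    then have qi: "q i > 0" using q(1)[OF that] by simp
    then have pi: "p i > 0" using p(2)[OF that] by simp
    have "ln (p i / (Z * q i)) \<le> p i / (Z * q i) - 1"
      using qi pi Zpos by (intro ln_le_minus_one) simp
    then have "ln (p i) - ln Z - ln (q i) \<le> p i / (Z * q i) - 1"
      using qi pi Zpos by (simp add: ln_div ln_mult)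
    then have "q i * (ln (p i) - ln Z - ln (q i)) \<le> q i * (p i / (Z * q i) - 1)"
      using qi by (intro mult_left_mono) auto
    also have "\<dots> = p i / Z - q i"
      using qi Zpos by (simp add: field_simps)
    finally show ?thesis by (simp add: algebra_simps)
  qed
  then have "(\<Sum>i\<in>I. - q i * ln (q i))
      \<le> (\<Sum>i\<in>I. - q i * ln (p i) + q i * ln Z + (p i / Z - q i))"
    by (rule sum_mono)
  also have "\<dots> = (\<Sum>i\<in>I. - q i * ln (p i)) + ln Z + (sum p I / Z - 1)"
    using q(2) by (simp add: sum.distrib sum_subtractf sum_negf flip: sum_distrib_right sum_divide_distrib)
  also have "\<dots> \<le> (\<Sum>i\<in>I. - q i * ln (p i)) + ln Z"
    using Z Zpos by (simp add: field_simps)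
  finally show ?thesis .
qed

text \<open>The limit is the infimum \<open>L\<close> of the quotients. For \<open>m\<close> with a
  nearly optimal quotient, writing \<open>n = k * m + r\<close> with \<open>r < m\<close> bounds
  \<open>u n / n\<close> by \<open>u m / m\<close> plus a vanishing remainder.\<close>

lemma fekete_subadditive_convergent:
  fixes u :: "nat \<Rightarrow> real"
  assumes sub: "\<And>m n. u (m + n) \<le> u m + u n" and nonneg: "\<And>n. u n \<ge> 0"
  shows "convergent (\<lambda>n. u (Suc n) / real (Suc n))"
proof -
  define S where "S = (\<lambda>n. u (Suc n) / real (Suc n)) ` UNIV"
  define L where "L = Inf S"
  have bdd: "bdd_below S"
    unfolding S_def using nonneg by (intro bdd_belowI[of _ 0]) auto
  have L_le: "L \<le> u (Suc n) / real (Suc n)" for n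
    unfolding L_def by (rule cInf_lower[OF _ bdd]) (auto simp: S_def)
  have mult: "u (k * m + r) \<le> real k * u m + u r" for k m r
  proof (induction k)
    case (Suc k)
    have "u (Suc k * m + r) \<le> u m + u (k * m + r)"
      using sub[of m "k * m + r"] by (simp add: add.assoc)
    with Suc show ?case by (simp add: algebra_simps)
  qed simp
  have "(\<lambda>n. u (Suc n) / real (Suc n)) \<longlonglongrightarrow> L"
  proof (rule LIMSEQ_I)
    fix e :: real assume "e > 0"
    then have "Inf S < L + e / 2" by (simp add: L_def)
    then obtain m0 where m0: "u (Suc m0) / real (Suc m0) < L + e / 2"
      using cInf_lessD[of S "L + e / 2"] by (auto simp: S_def)
    define m where "m = Suc m0"
    \<comment> \<open>Since \<open>u\<close> is nonnegative, this one number dominates every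
      remainder term \<open>u (n mod m)\<close>.\<close>
    define B where "B = (\<Sum>r<m. u r)"
    have B: "u r \<le> B" if "r < m" for r
      unfolding B_def using that nonneg by (intro member_le_sum) auto
    have upper: "u n / real n \<le> u m / real m + B / real n" if "n > 0" for n
    proof -
      have "u n \<le> real (n div m) * u m + u (n mod m)"
        using mult[of "n div m" m "n mod m"] by simp
      also have "u (n mod m) \<le> B" by (rule B) (simp add: m_def)
      also have "real (n div m) * u m \<le> (real n / real m) * u m"
        using nonneg by (intro mult_right_mono of_nat_div_le_of_nat)
      finally have "u n / real n \<le> (real n / real m * u m + B) / real n"
        by (intro divide_right_mono) auto
      then show ?thesis using that by (simp add: add_divide_distrib)
    qed
    obtain N where N: "real N > 2 * B / e" using reals_Archimedean2 by blast
    have "norm (u (Suc n) / real (Suc n) - L) < e" if "n \<ge> N" for n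
    proof -
      have "2 * B < e * real (Suc n)"
      proof -
        have "real N \<le> real (Suc n)" using that by simp
        then have "2 * B / e < real (Suc n)" using N by linarith
        then show ?thesis using \<open>e > 0\<close> by (simp add: field_simps)
      qed
      then have "B / real (Suc n) < e / 2" by (simp add: field_simps)
      moreover have "u (Suc n) / real (Suc n) \<le> u m / real m + B / real (Suc n)"
        by (rule upper) simp
      moreover have "u m / real m < L + e / 2" using m0 by (simp add: m_def)
      ultimately show ?thesis using L_le[of n] \<open>e > 0\<close> unfolding real_norm_def by linarith
    qed
    then show "\<exists>N. \<forall>n\<ge>N. norm (u (Suc n) / real (Suc n) - L) < e" by blast
  qed
  then show ?thesis by (auto simp: convergent_def)
qed

section \<open>Cylinders, coding words and conditional weights\<close>

fun cyl :: "'a measure \<Rightarrow> ('a \<Rightarrow> 'a) \<Rightarrow> 'a set list \<Rightarrow> 'a set" where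
  "cyl M T [] = space M"
| "cyl M T (A # as) = A \<inter> T -` cyl M T as \<inter> space M"

lemma cyl_subset_space: "cyl M T as \<subseteq> space M"
  by (cases as) auto

fun word :: "('a \<Rightarrow> 'a) \<Rightarrow> ('a \<Rightarrow> nat) \<Rightarrow> nat \<Rightarrow> 'a \<Rightarrow> nat list" where
  "word T c 0 x = []"
| "word T c (Suc n) x = c x # word T c n (T x)"

lemma length_word [simp]: "length (word T c n x) = n"
  by (induction n arbitrary: x) auto

lemma take_word: "k \<le> n \<Longrightarrow> take k (word T c n x) = word T c k x"
proof (induction n arbitrary: k x)
  case (Suc n)
  then show ?case by (cases k) auto
qed simp

text \<open>A conditional weight of an itinerary \<open>as\<close> given a coding word \<open>w\<close>: each letter is predicted
  from the next \<open>k\<close> symbols of \<open>w\<close>, a wrong prediction costing a factor \<open>s\<close>.\<close>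

fun choice_weight ::
  "real \<Rightarrow> nat \<Rightarrow> ('b list \<Rightarrow> 'a set) \<Rightarrow> 'a set list \<Rightarrow> 'b list \<Rightarrow> real" where
  "choice_weight s k pick [] w = 1"
| "choice_weight s k pick (A # as) w =
     (if A = pick (take k w) then 1 else s) * choice_weight s k pick as (tl w)"

lemma choice_weight_pos: "s > 0 \<Longrightarrow> choice_weight s k pick as w > 0"
  by (induction as arbitrary: w) auto

text \<open>For each letter at most one candidate is the predicted one, with weight 1, and the
  others weigh \<open>s\<close>. The prediction depends on \<open>w\<close> alone, so the sum over
  itineraries factors letter by letter.\<close>

lemma sum_choice_weight:
  assumes "finite P" "s > 0"
  shows "(\<Sum>as\<in>words P n. choice_weight s k pick as w) \<le> (1 + real (card P) * s) ^ n"
proof (induction n arbitrary: w)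
  case (Suc n)
  have "(\<Sum>A\<in>P. if A = pick (take k w) then 1 else s) \<le> (\<Sum>A\<in>P. (if A = pick (take k w) then 1 else 0) + s)"
    using assms by (intro sum_mono) auto
  also have "\<dots> \<le> 1 + real (card P) * s"
    using assms by (simp add: sum.distrib)
  finally have le: "(\<Sum>A\<in>P. if A = pick (take k w) then 1 else s) \<le> 1 + real (card P) * s" .
  have "(\<Sum>as\<in>words P (Suc n). choice_weight s k pick as w) =
      (\<Sum>A\<in>P. if A = pick (take k w) then 1 else s) * (\<Sum>as\<in>words P n. choice_weight s k pick as (tl w))"
    by (simp add: sum_words_Suc sum_distrib_right flip: sum_distrib_left)
  also have "\<dots> \<le> (1 + real (card P) * s) * (1 + real (card P) * s) ^ n"
    using assms Suc.IH[of "tl w"] le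
    by (intro mult_mono) (auto intro!: sum_nonneg less_imp_le[OF choice_weight_pos])
  finally show ?case by simp
qed simp

section \<open>Measure-preserving systems\<close>

locale measure_preserving_system = prob_space M for M :: "'a measure" +
  fixes T :: "'a \<Rightarrow> 'a"
  assumes invariant: "invariant_measure M T"
begin

lemma T_measurable [measurable]: "T \<in> M \<rightarrow>\<^sub>M M"
  using invariant by (simp add: invariant_measure_def)

lemma T_space: "x \<in> space M \<Longrightarrow> T x \<in> space M"
  using T_measurable by (rule measurable_space)

lemma distr_T: "distr M M T = M"
  using invariant by (intro measure_eqI) (auto simp: emeasure_distr invariant_measure_def)

lemma funpow_T_measurable [measurable]: "(T ^^ n) \<in> M \<rightarrow>\<^sub>M M"
proof (induction n)
  case (Suc n)
  have "T \<circ> T ^^ n \<in> M \<rightarrow>\<^sub>M M" by (rule measurable_comp[OF Suc T_measurable])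
  then show ?case by simp
qed (simp add: id_def)

lemma distr_funpow_T: "distr M M (T ^^ n) = M"
proof (induction n)
  case 0
  show ?case by (simp add: id_def distr_id)
next
  case (Suc n)
  have "distr M M (T ^^ Suc n) = distr (distr M M (T ^^ n)) M T"
    by (subst distr_distr) auto
  then show ?case by (simp only: distr_T Suc)
qed

lemma measure_funpow_vimage:
  "A \<in> sets M \<Longrightarrow> measure M ((T ^^ n) -` A \<inter> space M) = measure M A"
  using measure_distr[of "T ^^ n" M M A] by (simp add: distr_funpow_T)

lemma integral_funpow:
  fixes g :: "'a \<Rightarrow> real"
  assumes "integrable M g"
  shows "integrable M (\<lambda>x. g ((T ^^ n) x))" "(\<integral>x. g ((T ^^ n) x) \<partial>M) = (\<integral>x. g x \<partial>M)"
proof -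
  have [measurable]: "g \<in> borel_measurable M" using assms by simp
  show "integrable M (\<lambda>x. g ((T ^^ n) x))"
    using assms integrable_distr_eq[of "T ^^ n" M M g] by (simp add: distr_funpow_T)
  show "(\<integral>x. g ((T ^^ n) x) \<partial>M) = (\<integral>x. g x \<partial>M)"
    using integral_distr[of "T ^^ n" M M g] by (simp add: distr_funpow_T)
qed

lemma AE_funpow: "AE x in M. Q x \<Longrightarrow> AE x in M. Q ((T ^^ n) x)"
  by (rule AE_distrD[OF funpow_T_measurable]) (subst distr_funpow_T)

text \<open>The increment \<open>g (T x) - g x\<close> is nonnegative and has integral zero by
  invariance. This confines the measure to \<open>[0, b]\<close>, and later reduces it to the
  neutral point.\<close>

lemma AE_eq_of_monotone:
  fixes g :: "'a \<Rightarrow> real"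
  assumes g: "integrable M g" and mono: "AE x in M. g x \<le> g (T x)"
  shows "AE x in M. g (T x) = g x"
proof -
  note gT = integral_funpow[OF g, of 1]
  have "(\<integral>x. g (T x) - g x \<partial>M) = 0" using g gT by simp
  moreover have "integrable M (\<lambda>x. g (T x) - g x)" using g gT by simp
  moreover have "AE x in M. 0 \<le> g (T x) - g x" using mono by auto
  ultimately have "AE x in M. g (T x) - g x = 0"
    using integral_nonneg_eq_0_iff_AE by blast
  then show ?thesis by auto
qed

end

section \<open>Entropy of a finite partition\<close>

locale finite_partition_system = measure_preserving_system M T
  for M :: "'a measure" and T :: "'a \<Rightarrow> 'a" +
  fixes P :: "'a set set"
  assumes partition: "fin_partition M P"
begin

lemma finite_P: "finite P" and P_sets: "A \<in> P \<Longrightarrow> A \<in> sets M"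
  and P_cover: "\<Union>P = space M"
  using partition by (auto simp: fin_partition_def)

lemma P_disjoint: "A \<in> P \<Longrightarrow> B \<in> P \<Longrightarrow> x \<in> A \<Longrightarrow> x \<in> B \<Longrightarrow> A = B"
  using partition unfolding fin_partition_def disjoint_def by blast

lemma cyl_sets: "as \<in> words P n \<Longrightarrow> cyl M T as \<in> sets M"
proof (induction as arbitrary: n)
  case (Cons A as)
  then have "cyl M T as \<in> sets M" "A \<in> sets M"
    by (auto simp: words_def P_sets)
  then have "T -` cyl M T as \<inter> space M \<in> sets M" "A \<in> sets M"
    using measurable_sets[OF T_measurable] by auto
  then show ?case by (simp add: Int_assoc)
qed simp

lemma mem_cyl:
  "x \<in> cyl M T as \<longleftrightarrow> x \<in> space M \<and> (\<forall>i<length as. (T ^^ i) x \<in> as ! i)"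
proof (induction as arbitrary: x)
  case (Cons A as)
  have "(\<forall>i<Suc (length as). (T ^^ i) x \<in> (A # as) ! i) \<longleftrightarrow>
      x \<in> A \<and> (\<forall>i<length as. (T ^^ i) (T x) \<in> as ! i)"
    by (auto simp: less_Suc_eq_0_disj funpow_swap1)
  then show ?case using Cons T_space by auto
qed simp

lemma cyl_append:
  "cyl M T (as @ bs) = cyl M T as \<inter> ((T ^^ length as) -` cyl M T bs \<inter> space M)"
proof (induction as)
  case Nil
  show ?case using cyl_subset_space[of M T bs] by auto
next
  case (Cons A as)
  show ?case using T_space by (auto simp: Cons funpow_swap1)
qed

lemma cyl_disjoint:
  assumes "as \<in> words P n" "bs \<in> words P n" "x \<in> cyl M T as" "x \<in> cyl M T bs"
  shows "as = bs"
proof (rule nth_equalityI)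
  show "length as = length bs" using assms by (simp add: words_def)
  show "as ! i = bs ! i" if "i < length as" for i
    using assms that by (intro P_disjoint[of _ _ "(T ^^ i) x"]) (auto simp: words_def mem_cyl subset_iff)
qed

lemma cyl_cover:
  assumes "x \<in> space M"
  obtains as where "as \<in> words P n" "x \<in> cyl M T as"
  using assms
proof (induction n arbitrary: x thesis)
  case (Suc n)
  obtain as where as: "as \<in> words P n" "T x \<in> cyl M T as"
    using Suc.IH[of "T x"] T_space[OF Suc.prems(2)] by blast
  obtain A where "A \<in> P" "x \<in> A" using Suc.prems(2) P_cover by blast
  with as Suc.prems(2) show ?case
    by (intro Suc.prems(1)[of "A # as"]) (auto simp: words_def)
qed auto

text \<open>Summing over words instead of the sets of the join keeps the index set a product under
  concatenation. Words with empty cylinder contribute nothing, as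
  \<open>0 * ln 0 = 0\<close>.\<close>

definition block_entropy :: "nat \<Rightarrow> real" where
  "block_entropy n = (\<Sum>as\<in>words P n. - measure M (cyl M T as) * ln (measure M (cyl M T as)))"

lemma join_partition_eq: "join_partition M T P n = cyl M T ` words P n - {{}}"
proof -
  have eq: "cyl M T as = space M \<inter> (\<Inter>i\<in>{..<n}. (T ^^ i) -` (as ! i))" if "length as = n" for as
    using that by (auto simp: mem_cyl)
  have "(\<exists>a. (\<forall>i<n. a i \<in> P) \<and> A = space M \<inter> (\<Inter>i\<in>{..<n}. (T ^^ i) -` a i))
      \<longleftrightarrow> A \<in> cyl M T ` words P n" (is "(\<exists>a. ?join a) \<longleftrightarrow> _") for A
  proof
    assume "\<exists>a. ?join a"
    then obtain a where a: "?join a" ..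
    then have "A = cyl M T (map a [0..<n])" by (simp add: eq)
    moreover have "map a [0..<n] \<in> words P n" using a by (auto simp: words_def)
    ultimately show "A \<in> cyl M T ` words P n" by (rule image_eqI)
  next
    assume "A \<in> cyl M T ` words P n"
    then obtain as where as: "as \<in> words P n" "A = cyl M T as" by blast
    then have "?join ((!) as)" by (auto simp: eq words_def)
    then show "\<exists>a. ?join a" by (rule exI[of ?join])
  qed
  then show ?thesis
    unfolding join_partition_def by auto
qed

lemma partition_entropy_join: "partition_entropy M (join_partition M T P n) = block_entropy n"
proof -
  let ?W = "{as \<in> words P n. cyl M T as \<noteq> {}}"
  have "inj_on (cyl M T) ?W"
    using cyl_disjoint by (auto intro!: inj_onI)
  moreover have "join_partition M T P n = cyl M T ` ?W"
    unfolding join_partition_eq by auto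
  moreover have "block_entropy n =
      (\<Sum>as\<in>?W. - measure M (cyl M T as) * ln (measure M (cyl M T as)))"
    unfolding block_entropy_def using finite_P
    by (intro sum.mono_neutral_right) auto
  ultimately show ?thesis
    by (simp add: partition_entropy_def sum.reindex sum_negf)
qed

lemma sum_measure_disjoint:
  assumes "finite I" and E: "\<And>i. i \<in> I \<Longrightarrow> E i \<in> sets M"
    and disj: "\<And>i j x. i \<in> I \<Longrightarrow> j \<in> I \<Longrightarrow> x \<in> E i \<Longrightarrow> x \<in> E j \<Longrightarrow> i = j"
  shows "(\<Sum>i\<in>I. measure M (E i)) = measure M (\<Union>i\<in>I. E i)"
proof -
  have "disjoint_family_on E I" using disj by (auto simp: disjoint_family_on_def)
  then show ?thesis using finite_measure_finite_Union[of I E] assms(1) E by (simp add: image_subset_iff)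
qed

lemma sum_measure_cyl: "(\<Sum>as\<in>words P n. measure M (cyl M T as)) = 1"
proof -
  have "(\<Union>as\<in>words P n. cyl M T as) = space M"
    using cyl_subset_space[of M T] by (auto elim: cyl_cover simp: subset_iff)
  then show ?thesis
    using cyl_sets cyl_disjoint finite_P prob_space
    by (subst sum_measure_disjoint) auto
qed

lemma block_entropy_nonneg: "block_entropy n \<ge> 0"
  unfolding block_entropy_def
proof (intro sum_nonneg)
  fix as
  show "0 \<le> - measure M (cyl M T as) * ln (measure M (cyl M T as))"
  proof (cases "measure M (cyl M T as) = 0")
    case False
    then have "measure M (cyl M T as) > 0" by (simp add: zero_less_measure_iff)
    then have "ln (measure M (cyl M T as)) \<le> 0" by simp
    then show ?thesis by (simp add: mult_nonneg_nonpos)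
  qed simp
qed

text \<open>Gibbs' inequality against the product of the laws of the two blocks: the logarithm of a
  product splits, and each half then sums to a marginal.\<close>

lemma block_entropy_subadditive: "block_entropy (m + n) \<le> block_entropy m + block_entropy n"
proof -
  let ?W = "words P (m + n)" and ?\<mu> = "\<lambda>as. measure M (cyl M T as)"
  define p where "p as = ?\<mu> (take m as) * ?\<mu> (drop m as)" for as
  have split: "p (as @ bs) = ?\<mu> as * ?\<mu> bs" if "as \<in> words P m" for as bs
    using that by (simp add: p_def words_def)
  have marg1: "(\<Sum>bs\<in>words P n. ?\<mu> (as @ bs)) = ?\<mu> as" if as: "as \<in> words P m" for as
  proof -
    have "(\<Sum>bs\<in>words P n. ?\<mu> (as @ bs)) = measure M (\<Union>bs\<in>words P n. cyl M T (as @ bs))"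
    proof (rule sum_measure_disjoint)
      show "cyl M T (as @ bs) \<in> sets M" if "bs \<in> words P n" for bs
        using as that by (intro cyl_sets[of _ "m + n"]) (auto simp: words_append)
      show "bs = bs'" if "bs \<in> words P n" "bs' \<in> words P n"
        "x \<in> cyl M T (as @ bs)" "x \<in> cyl M T (as @ bs')" for bs bs' x
        using that cyl_disjoint[of "as @ bs" "m + n" "as @ bs'" x] as
        by (auto simp: words_def)
    qed (use finite_P in auto)
    also have "(\<Union>bs\<in>words P n. cyl M T (as @ bs)) = cyl M T as"
    proof -
      have "x \<in> (\<Union>bs\<in>words P n. cyl M T (as @ bs))" if "x \<in> cyl M T as" for x
      proof -
        have "x \<in> space M" using that cyl_subset_space[of M T as] by auto
        then have "(T ^^ length as) x \<in> space M" by (meson funpow_T_measurable measurable_space)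
        from cyl_cover[OF this, of n] show ?thesis
          using that \<open>x \<in> space M\<close> by (auto simp: cyl_append)
      qed
      then show ?thesis by (auto simp: cyl_append)
    qed
    finally show ?thesis .
  qed
  \<comment> \<open>Unlike \<open>marg1\<close>, this marginal needs invariance: forgetting the
    first \<open>m\<close> letters leaves a preimage under \<open>T ^^ m\<close>.\<close>
  have marg2: "(\<Sum>as\<in>words P m. ?\<mu> (as @ bs)) = ?\<mu> bs" if bs: "bs \<in> words P n" for bs
  proof -
    have "(\<Sum>as\<in>words P m. ?\<mu> (as @ bs)) = measure M (\<Union>as\<in>words P m. cyl M T (as @ bs))"
    proof (rule sum_measure_disjoint)
      show "cyl M T (as @ bs) \<in> sets M" if "as \<in> words P m" for as
        using bs that by (intro cyl_sets[of _ "m + n"]) (auto simp: words_append)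
      show "as = as'" if "as \<in> words P m" "as' \<in> words P m"
        "x \<in> cyl M T (as @ bs)" "x \<in> cyl M T (as' @ bs)" for as as' x
        using that cyl_disjoint[of "as @ bs" "m + n" "as' @ bs" x] bs
        by (auto simp: words_def)
    qed (use finite_P in auto)
    also have "(\<Union>as\<in>words P m. cyl M T (as @ bs)) = (T ^^ m) -` cyl M T bs \<inter> space M"
    proof -
      have len: "length as = m" if "as \<in> words P m" for as using that by (simp add: words_def)
      show ?thesis
        by (auto simp: cyl_append len elim: cyl_cover)
    qed
    also have "measure M \<dots> = ?\<mu> bs"
      by (rule measure_funpow_vimage[OF cyl_sets[OF bs]])
    finally show ?thesis .
  qed
  have le1: "?\<mu> (as @ bs) \<le> ?\<mu> as" if "as \<in> words P m" for as bs
    using that cyl_sets by (intro finite_measure_mono) (auto simp: cyl_append)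
  have le2: "?\<mu> (as @ bs) \<le> ?\<mu> bs" if "as \<in> words P m" "bs \<in> words P n" for as bs
    using marg2[OF that(2)] that finite_P member_le_sum[of as "words P m" "\<lambda>as. ?\<mu> (as @ bs)"] by auto
  have "block_entropy (m + n) \<le> (\<Sum>as\<in>?W. - ?\<mu> as * ln (p as)) + ln 1"
    unfolding block_entropy_def
  proof (rule gibbs_inequality)
    show "sum p ?W \<le> 1"
      by (simp add: sum_words_append split sum_measure_cyl flip: sum_distrib_left)
    show "p as > 0" if "as \<in> ?W" "?\<mu> as > 0" for as
    proof -
      from that(1) obtain u v where "as = u @ v" "u \<in> words P m" "v \<in> words P n"
        by (auto simp: words_append)
      with that(2) le1[of u v] le2[of u v] split[of u v] show ?thesis by simp
    qed
  qed (use finite_P sum_measure_cyl in \<open>auto simp: p_def\<close>)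
  also have "\<dots> = (\<Sum>as\<in>words P m. \<Sum>bs\<in>words P n. - ?\<mu> (as @ bs) * (ln (?\<mu> as) + ln (?\<mu> bs)))"
  proof -
    have "- ?\<mu> (as @ bs) * ln (p (as @ bs)) = - ?\<mu> (as @ bs) * (ln (?\<mu> as) + ln (?\<mu> bs))"
      if "as \<in> words P m" "bs \<in> words P n" for as bs
    proof (cases "?\<mu> (as @ bs) = 0")
      case False
      then have "?\<mu> as > 0" "?\<mu> bs > 0"
        using le1[of as bs] le2[of as bs] that by (smt (verit) measure_nonneg)+
      then show ?thesis using split[of as bs] that by (simp add: ln_mult)
    qed simp
    then show ?thesis
      unfolding sum_words_append by simp (intro sum.cong refl, simp)
  qed
  also have "\<dots> = (\<Sum>as\<in>words P m. \<Sum>bs\<in>words P n. ?\<mu> (as @ bs) * (- ln (?\<mu> as)))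
      + (\<Sum>bs\<in>words P n. \<Sum>as\<in>words P m. ?\<mu> (as @ bs) * (- ln (?\<mu> bs)))"
    by (subst (2) sum.swap) (simp add: algebra_simps sum.distrib sum_subtractf sum_negf)
  also have "\<dots> = block_entropy m + block_entropy n"
    unfolding sum_distrib_right[symmetric] block_entropy_def by (simp add: marg1 marg2)
  finally show ?thesis .
qed

text \<open>Subadditivity gives convergence, so the \<open>lim\<close> in the definition of the
  entropy is a genuine limit.\<close>

lemma entropy_wrt_partition_limit:
  "(\<lambda>n. block_entropy (Suc n) / real (Suc n)) \<longlonglongrightarrow> entropy_wrt_partition M T P"
  using fekete_subadditive_convergent[of block_entropy, OF block_entropy_subadditive block_entropy_nonneg]
  unfolding entropy_wrt_partition_def partition_entropy_join
  by (simp add: convergent_LIMSEQ_iff)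


section \<open>Bounding entropy by a weighted coding\<close>

lemma word_sets:
  assumes [measurable]: "c \<in> M \<rightarrow>\<^sub>M count_space UNIV"
  shows "{x \<in> space M. word T c n x = w} \<in> sets M"
proof (induction n arbitrary: w)
  case (Suc n)
  show ?case
  proof (cases w)
    case (Cons j v)
    have "{x \<in> space M. word T c (Suc n) x = w} =
        {x \<in> space M. c x = j} \<inter> (T -` {x \<in> space M. word T c n x = v} \<inter> space M)"
      using Cons T_space by auto
    also have "\<dots> \<in> sets M"
      using measurable_sets[OF T_measurable Suc] by measurable
    finally show ?thesis .
  qed simp
qed simp

text \<open>The sum is the integral of the step function with value \<open>c i\<close> on
  \<open>E i\<close>, which lies below \<open>B\<close> almost everywhere.\<close>

lemma sum_measure_le_integral:
  fixes B :: "'a \<Rightarrow> real"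
  assumes "finite I" and E: "\<And>i. i \<in> I \<Longrightarrow> E i \<in> sets M"
    and disj: "\<And>i j x. i \<in> I \<Longrightarrow> j \<in> I \<Longrightarrow> x \<in> E i \<Longrightarrow> x \<in> E j \<Longrightarrow> i = j"
    and full: "AE x in M. x \<in> (\<Union>i\<in>I. E i)"
    and B: "integrable M B" "\<And>i x. i \<in> I \<Longrightarrow> x \<in> E i \<Longrightarrow> c i \<le> B x"
  shows "(\<Sum>i\<in>I. measure M (E i) * c i) \<le> (\<integral>x. B x \<partial>M)"
proof -
  have int: "integrable M (\<lambda>x. indicat_real (E i) x * c i)" if "i \<in> I" for i
    using E[OF that] by (intro integrable_mult_left integrable_real_indicator) (auto simp: emeasure_eq_measure)
  have "(\<Sum>i\<in>I. measure M (E i) * c i) = (\<Sum>i\<in>I. \<integral>x. indicat_real (E i) x * c i \<partial>M)"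
    using E sets.sets_into_space by (intro sum.cong refl) (simp add: Int_absorb2)
  also have "\<dots> = (\<integral>x. (\<Sum>i\<in>I. indicat_real (E i) x * c i) \<partial>M)"
    using int by (subst Bochner_Integration.integral_sum) auto
  also have "\<dots> \<le> (\<integral>x. B x \<partial>M)"
  proof (rule integral_mono_AE)
    show "AE x in M. (\<Sum>i\<in>I. indicat_real (E i) x * c i) \<le> B x"
      using full
    proof eventually_elim
      fix x assume "x \<in> (\<Union>i\<in>I. E i)"
      then obtain j where j: "j \<in> I" "x \<in> E j" by blast
      then have "(\<Sum>i\<in>I. indicat_real (E i) x * c i) = (\<Sum>i\<in>I. if i = j then c j else 0)"
        using disj by (intro sum.cong refl) (auto simp: indicator_def)
      then show "(\<Sum>i\<in>I. indicat_real (E i) x * c i) \<le> B x"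
        using j B(2) \<open>finite I\<close> by simp
    qed
  qed (use int B in auto)
  finally show ?thesis .
qed

text \<open>Gibbs' inequality for the joint law of \<open>P\<close>-itineraries of length
  \<open>n\<close> and coding words of length \<open>n + k\<close>. The weight of a pair is
  \<open>m w\<close> times the conditional weight of the itinerary. The \<open>k\<close> extra
  symbols let each of the \<open>n\<close> letters be predicted from \<open>k\<close> symbols of the
  word. By invariance a wrong prediction, possible only in \<open>bad\<close>, costs on average at
  most \<open>- ln s * measure M bad\<close> per letter.\<close>

lemma block_entropy_le:
  assumes \<Lambda>: "\<Lambda> \<in> sets M" "AE x in M. x \<in> \<Lambda>" "\<And>x. x \<in> \<Lambda> \<Longrightarrow> T x \<in> \<Lambda>"
    and c: "c \<in> M \<rightarrow>\<^sub>M count_space UNIV" "\<And>x. x \<in> \<Lambda> \<Longrightarrow> c x < d"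
    and m: "\<And>w. set w \<subseteq> {..<d} \<Longrightarrow> m w > 0" "sum m (words {..<d} (n + k)) \<le> Z"
    and g: "integrable M g" "\<And>x. x \<in> \<Lambda> \<Longrightarrow> - ln (m (word T c (n + k) x)) \<le> g x"
    and bad: "bad \<in> sets M" "\<And>x. x \<in> \<Lambda> \<Longrightarrow> x \<notin> bad \<Longrightarrow> x \<in> pick (word T c k x)" "\<And>v. pick v \<in> P"
    and s: "0 < s" "s < 1"
  shows "block_entropy n \<le> ln (Z * (1 + real (card P) * s) ^ n) + (\<integral>x. g x \<partial>M)
    - real n * (ln s * measure M bad)"
proof -
  let ?N = "n + k" and ?I = "words P n \<times> words {..<d} (n + k)"
  define E where "E = (\<lambda>(as, w). cyl M T as \<inter> \<Lambda> \<inter> {x \<in> space M. word T c ?N x = w})"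
  define q where "q i = measure M (E i)" for i
  define p where "p = (\<lambda>(as, w). m w * choice_weight s k pick as w)"
  \<comment> \<open>A pointwise bound for \<open>- ln (p i)\<close> on \<open>E i\<close>:
    \<open>g\<close> for the coding word, and \<open>- ln s\<close> for each time before
    \<open>n\<close> that the orbit spends in \<open>bad\<close>.\<close>
  define B where "B x = g x + (\<Sum>i<n. - ln s * indicat_real bad ((T ^^ i) x))" for x
  have fin: "finite ?I" using finite_P by auto
  have wpos: "m w > 0" if "w \<in> words {..<d} ?N" for w using that m(1) by (auto simp: words_def)
  have ppos: "p i > 0" if "i \<in> ?I" for i
    using that wpos choice_weight_pos[OF s(1)] by (auto simp: p_def intro!: mult_pos_pos)
  have E_sets: "E i \<in> sets M" if "i \<in> ?I" for i
    using that cyl_sets \<Lambda>(1) word_sets[OF c(1)] unfolding E_def by auto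
  have E_disj: "i = j" if "i \<in> ?I" "j \<in> ?I" "x \<in> E i" "x \<in> E j" for i j x
    using that cyl_disjoint by (auto simp: E_def)
  have word_in: "word T c r x \<in> words {..<d} r" if "x \<in> \<Lambda>" for x r
    using that by (induction r arbitrary: x) (auto simp: words_def \<Lambda>(3) c(2))
  have \<Lambda>_space: "\<Lambda> \<subseteq> space M" using \<Lambda>(1) by (rule sets.sets_into_space)
  have E_cover: "x \<in> (\<Union>i\<in>?I. E i)" if x: "x \<in> \<Lambda>" for x
  proof -
    have "x \<in> space M" using x \<Lambda>_space by auto
    then obtain as where "as \<in> words P n" "x \<in> cyl M T as" by (rule cyl_cover)
    with x \<open>x \<in> space M\<close> word_in[OF x, of ?N] show ?thesis
      by (intro UN_I[of "(as, word T c ?N x)"]) (auto simp: E_def)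
  qed
  have E_full: "AE x in M. x \<in> (\<Union>i\<in>?I. E i)"
    using \<Lambda>(2) by eventually_elim (rule E_cover)
  have "measure M (\<Union>i\<in>?I. E i) = 1"
    using E_full E_sets fin by (intro prob_eq_1[THEN iffD2]) (auto intro!: sets.finite_UN)
  then have q_sum: "sum q ?I = 1"
    unfolding q_def using sum_measure_disjoint[of ?I E] fin E_sets E_disj by simp
  have marg: "(\<Sum>w\<in>words {..<d} ?N. q (as, w)) = measure M (cyl M T as)" if as: "as \<in> words P n" for as
  proof -
    have "(\<Sum>w\<in>words {..<d} ?N. q (as, w)) = measure M (\<Union>w\<in>words {..<d} ?N. E (as, w))"
      unfolding q_def using as E_sets by (intro sum_measure_disjoint) (auto simp: E_def)
    also have "\<dots> = measure M (cyl M T as)"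
    proof (rule finite_measure_eq_AE)
      show "AE x in M. x \<in> (\<Union>w\<in>words {..<d} ?N. E (as, w)) \<longleftrightarrow> x \<in> cyl M T as"
        using \<Lambda>(2)
      proof eventually_elim
        fix x assume "x \<in> \<Lambda>"
        then show "x \<in> (\<Union>w\<in>words {..<d} ?N. E (as, w)) \<longleftrightarrow> x \<in> cyl M T as"
          using word_in[of x ?N] \<Lambda>_space by (auto simp: E_def)
      qed
    qed (use as E_sets cyl_sets in \<open>auto intro!: sets.finite_UN\<close>)
    finally show ?thesis .
  qed
  \<comment> \<open>Refining by the coding word can only raise the entropy, because
    \<open>q (as, w)\<close> is at most the measure of the cylinder of \<open>as\<close>.\<close>
  have "block_entropy n \<le> (\<Sum>as\<in>words P n. \<Sum>w\<in>words {..<d} ?N. - q (as, w) * ln (q (as, w)))"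
    unfolding block_entropy_def
  proof (rule sum_mono)
    fix as assume as: "as \<in> words P n"
    have "- q (as, w) * ln (measure M (cyl M T as)) \<le> - q (as, w) * ln (q (as, w))" for w
    proof (cases "q (as, w) = 0")
      case False
      then have pos: "q (as, w) > 0" by (simp add: q_def zero_less_measure_iff)
      have "q (as, w) \<le> measure M (cyl M T as)"
        unfolding q_def E_def using cyl_sets[OF as] by (intro finite_measure_mono) auto
      then show ?thesis using pos by simp
    qed simp
    then have "(\<Sum>w\<in>words {..<d} ?N. - q (as, w) * ln (measure M (cyl M T as)))
        \<le> (\<Sum>w\<in>words {..<d} ?N. - q (as, w) * ln (q (as, w)))" by (intro sum_mono)
    then show "- measure M (cyl M T as) * ln (measure M (cyl M T as))
        \<le> (\<Sum>w\<in>words {..<d} ?N. - q (as, w) * ln (q (as, w)))"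
      by (simp add: marg[OF as] sum_negf flip: sum_distrib_right)
  qed
  also have "\<dots> = (\<Sum>i\<in>?I. - q i * ln (q i))"
    by (simp add: sum.cartesian_product case_prod_unfold)
  also have "\<dots> \<le> (\<Sum>i\<in>?I. - q i * ln (p i)) + ln (Z * (1 + real (card P) * s) ^ n)"
  proof (rule gibbs_inequality)
    have "sum p ?I = (\<Sum>w\<in>words {..<d} ?N. \<Sum>as\<in>words P n. p (as, w))"
      by (subst sum.swap) (simp add: sum.cartesian_product case_prod_unfold)
    also have "\<dots> = (\<Sum>w\<in>words {..<d} ?N. m w * (\<Sum>as\<in>words P n. choice_weight s k pick as w))"
      by (simp add: p_def sum_distrib_left)
    also have "\<dots> \<le> (\<Sum>w\<in>words {..<d} ?N. m w * (1 + real (card P) * s) ^ n)"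
      using s finite_P wpos
      by (intro sum_mono mult_left_mono sum_choice_weight) (auto intro: less_imp_le)
    also have "\<dots> = sum m (words {..<d} ?N) * (1 + real (card P) * s) ^ n"
      by (simp add: sum_distrib_right)
    also have "\<dots> \<le> Z * (1 + real (card P) * s) ^ n"
      using m(2) s by (intro mult_right_mono) auto
    finally show "sum p ?I \<le> Z * (1 + real (card P) * s) ^ n" .
  qed (use fin q_sum ppos in \<open>auto simp: q_def intro: less_imp_le\<close>)
  also have "(\<Sum>i\<in>?I. - q i * ln (p i)) = (\<Sum>i\<in>?I. measure M (E i) * - ln (p i))"
    by (simp add: q_def)
  also have "\<dots> \<le> (\<integral>x. B x \<partial>M)"
  proof (rule sum_measure_le_integral[OF fin E_sets E_disj E_full])
    have [measurable]: "bad \<in> sets M" by fact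
    have bad_int: "integrable M (indicat_real bad)"
      using bad(1) by (intro integrable_real_indicator) (auto simp: emeasure_eq_measure)
    show "integrable M B"
      unfolding B_def using integral_funpow(1)[OF bad_int] g(1) by auto
    \<comment> \<open>Passing from \<open>x\<close> to \<open>T x\<close> drops the first letter of
      both the itinerary and the word, so an induction on the itinerary compares one letter at a
      time.\<close>
    have choice: "- ln (choice_weight s k pick as (word T c (length as + k) x))
        \<le> (\<Sum>i<length as. - ln s * indicat_real bad ((T ^^ i) x))"
      if "x \<in> \<Lambda>" "x \<in> cyl M T as" "set as \<subseteq> P" for as x
      using that
    proof (induction as arbitrary: x)
      case (Cons A as)
      let ?v = "word T c (Suc (length as) + k) x"
      let ?h = "if A = pick (take k ?v) then 1 else s"
      have "take k ?v = word T c k x" by (rule take_word) simp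
      moreover have "A = pick (word T c k x)" if "x \<notin> bad"
        using bad(2)[OF Cons.prems(1) that] bad(3) Cons.prems by (intro P_disjoint[of _ _ x]) auto
      ultimately have head: "- ln ?h \<le> - ln s * indicat_real bad x"
        using s by (auto simp: indicator_def)
      have "T x \<in> \<Lambda>" "T x \<in> cyl M T as" "set as \<subseteq> P" using Cons.prems \<Lambda>(3) by auto
      note IH = Cons.IH[OF this]
      have "- ln (choice_weight s k pick (A # as) ?v) =
          - ln ?h + - ln (choice_weight s k pick as (word T c (length as + k) (T x)))"
        using s choice_weight_pos[OF s(1), of k pick as "word T c (length as + k) (T x)"]
        by (simp add: ln_mult)
      also have "\<dots> \<le> - ln s * indicat_real bad x + (\<Sum>i<length as. - ln s * indicat_real bad ((T ^^ i) (T x)))"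
        using head IH by linarith
      also have "\<dots> = (\<Sum>i<length (A # as). - ln s * indicat_real bad ((T ^^ i) x))"
        unfolding length_Cons sum.lessThan_Suc_shift by (simp add: funpow_swap1)
      finally show ?case by simp
    qed simp
    show "- ln (p i) \<le> B x" if i: "i \<in> ?I" and x: "x \<in> E i" for i x
    proof -
      obtain as w where i_eq: "i = (as, w)" by (cases i)
      then have *: "x \<in> \<Lambda>" "x \<in> cyl M T as" "set as \<subseteq> P" "length as = n" "w = word T c ?N x"
        using i x by (auto simp: E_def words_def)
      have "- ln (p i) = - ln (m w) - ln (choice_weight s k pick as w)"
        using i choice_weight_pos[OF s(1), of k pick as w] wpos[of w] by (simp add: i_eq p_def ln_mult)
      then show ?thesis
        using choice[OF *(1-3)] g(2)[OF *(1)] * by (simp add: B_def)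
    qed
  qed
  also have "(\<integral>x. B x \<partial>M) = (\<integral>x. g x \<partial>M) - real n * (ln s * measure M bad)"
  proof -
    have bad_int: "integrable M (indicat_real bad)"
      using bad(1) by (intro integrable_real_indicator) (auto simp: emeasure_eq_measure)
    have "(\<integral>x. indicat_real bad ((T ^^ i) x) \<partial>M) = measure M bad" for i
      using integral_funpow(2)[OF bad_int, of i] bad(1) sets.sets_into_space by (simp add: Int_absorb2)
    then have "(\<integral>x. (\<Sum>i<n. - ln s * indicat_real bad ((T ^^ i) x)) \<partial>M) = - real n * (ln s * measure M bad)"
      using integral_funpow(1)[OF bad_int]
      by (subst Bochner_Integration.integral_sum) (auto simp del: sum_mult_indicator)
    then show ?thesis
      unfolding B_def using integral_funpow(1)[OF bad_int] g(1)
      by (subst Bochner_Integration.integral_add) auto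
  qed
  finally show ?thesis by simp
qed

text \<open>Divide the block bound by \<open>n\<close>. The quantities \<open>ln Z\<close>,
  \<open>C\<close> and \<open>k\<close> stay fixed and disappear in the limit. The three errors that
  grow linearly, from the mass of wrong predictions, from their cost and from the weights, get
  \<open>e / 3\<close> per letter each.\<close>

theorem entropy_wrt_partition_le:
  assumes \<Lambda>: "\<Lambda> \<in> sets M" "AE x in M. x \<in> \<Lambda>" "\<And>x. x \<in> \<Lambda> \<Longrightarrow> T x \<in> \<Lambda>"
    and c: "c \<in> M \<rightarrow>\<^sub>M count_space UNIV" "\<And>x. x \<in> \<Lambda> \<Longrightarrow> c x < d"
    and m: "\<And>w. set w \<subseteq> {..<d} \<Longrightarrow> m w > 0" "\<And>n. sum m (words {..<d} n) \<le> Z"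
    and \<Phi>: "integrable M \<Phi>"
    and weight: "\<And>e. e > 0 \<Longrightarrow> \<exists>C. \<forall>n. \<forall>x\<in>\<Lambda>.
        - ln (m (word T c n x)) \<le> (\<Sum>i<n. \<Phi> ((T ^^ i) x)) + C + e * real n"
    and generating: "\<And>e. e > 0 \<Longrightarrow> \<exists>k pick bad. bad \<in> sets M \<and> measure M bad \<le> e \<and>
        (\<forall>v. pick v \<in> P) \<and> (\<forall>x\<in>\<Lambda> - bad. x \<in> pick (word T c k x))"
  shows "entropy_wrt_partition M T P \<le> (\<integral>x. \<Phi> x \<partial>M)"
proof (rule field_le_epsilon)
  fix e :: real assume "e > 0"
  \<comment> \<open>The second entry makes \<open>card P * s \<le> e / 3\<close>, with
    \<open>+ 1\<close> keeping the denominator positive; the bound \<open>1/2\<close> keeps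
    \<open>- ln s\<close> positive.\<close>
  define s where "s = min (1/2) (e / 3 / (real (card P) + 1))"
  have s: "0 < s" "s < 1" using \<open>e > 0\<close> by (auto simp: s_def)
  have "real (card P) * s \<le> (real (card P) + 1) * (e / 3 / (real (card P) + 1))"
    unfolding s_def using \<open>e > 0\<close> by (intro mult_mono) auto
  also have "\<dots> = e / 3" by (simp add: field_simps)
  finally have Ps: "real (card P) * s \<le> e / 3" .
  have lns: "- ln s > 0" using s by simp
  \<comment> \<open>The penalty \<open>s\<close> is already fixed, so \<open>bad\<close> can be made
    small enough that wrong predictions cost at most \<open>e / 3\<close> per letter.\<close>
  obtain k pick bad where bad: "bad \<in> sets M" "measure M bad \<le> e / 3 / (- ln s)"
      "\<And>v. pick v \<in> P" "\<And>x. x \<in> \<Lambda> \<Longrightarrow> x \<notin> bad \<Longrightarrow> x \<in> pick (word T c k x)"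
  proof -
    have "e / 3 / (- ln s) > 0" using lns \<open>e > 0\<close> by (intro divide_pos_pos) auto
    from generating[OF this] show thesis using that by blast
  qed
  obtain C where C: "\<And>n x. x \<in> \<Lambda> \<Longrightarrow>
      - ln (m (word T c n x)) \<le> (\<Sum>i<n. \<Phi> ((T ^^ i) x)) + C + e / 3 * real n"
    using weight[of "e / 3"] \<open>e > 0\<close> by auto
  define J where "J = (\<integral>x. \<Phi> x \<partial>M)"
  have "0 < m []" using m(1)[of "[]"] by simp
  then have Z: "Z > 0" using m(2)[of 0] by simp
  \<comment> \<open>Everything in the block bound that does not depend on \<open>n\<close>.\<close>
  define D where "D = ln Z + real k * J + C + e / 3 * real k"
  have bound: "block_entropy n \<le> D + real n * (J + e)" for n
  proof -
    define g where "g x = (\<Sum>i<n + k. \<Phi> ((T ^^ i) x)) + C + e / 3 * real (n + k)" for x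
    have g_int: "integrable M g"
      unfolding g_def using integral_funpow(1)[OF \<Phi>] by auto
    have g_eq: "(\<integral>x. g x \<partial>M) = real (n + k) * J + C + e / 3 * real (n + k)"
      unfolding g_def J_def using integral_funpow[OF \<Phi>] by (simp add: prob_space)
    have "block_entropy n \<le> ln (Z * (1 + real (card P) * s) ^ n) + (\<integral>x. g x \<partial>M)
        - real n * (ln s * measure M bad)"
      using C[of _ "n + k"] by (intro block_entropy_le[OF \<Lambda> c m g_int _ bad(1,4,3) s]) (simp_all add: g_def)
    moreover have "ln (Z * (1 + real (card P) * s) ^ n) = ln Z + real n * ln (1 + real (card P) * s)"
    proof -
      have "1 + real (card P) * s > 0" using s by (intro add_pos_nonneg) auto
      then show ?thesis using Z by (simp add: ln_mult ln_realpow)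
    qed
    moreover have "real n * ln (1 + real (card P) * s) \<le> real n * (e / 3)"
      using Ps s ln_add_one_self_le_self[of "real (card P) * s"] by (intro mult_left_mono) auto
    moreover have "real n * - (ln s * measure M bad) \<le> real n * (e / 3)"
    proof (intro mult_left_mono)
      have "measure M bad * (- ln s) \<le> e / 3" using bad(2) lns by (simp only: pos_le_divide_eq)
      then show "- (ln s * measure M bad) \<le> e / 3" by (simp add: mult.commute)
    qed simp
    moreover have "real n * (e / 3) + real n * (e / 3) + e / 3 * real (n + k) = real n * e + e / 3 * real k"
      by (simp add: field_simps)
    ultimately show ?thesis
      by (simp add: g_eq D_def algebra_simps)
  qed
  have "(\<lambda>n. D / real (Suc n) + (J + e)) \<longlonglongrightarrow> 0 + (J + e)"
    by (intro tendsto_add tendsto_const LIMSEQ_Suc lim_const_over_n)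
  then have "entropy_wrt_partition M T P \<le> 0 + (J + e)"
  proof (rule LIMSEQ_le[OF entropy_wrt_partition_limit])
    have "block_entropy (Suc n) / real (Suc n) \<le> D / real (Suc n) + (J + e)" for n
      using divide_right_mono[OF bound[of "Suc n"], of "real (Suc n)"] by (simp add: add_divide_distrib)
    then show "\<exists>N. \<forall>n\<ge>N. block_entropy (Suc n) / real (Suc n) \<le> D / real (Suc n) + (J + e)"
      by blast
  qed
  then show "entropy_wrt_partition M T P \<le> (\<integral>x. \<Phi> x \<partial>M) + e" by (simp add: J_def)
qed

end

section \<open>Full-branch maps with a neutral fixed point\<close>

lemma DERIV_nonneg_le:
  fixes f f' :: "real \<Rightarrow> real"
  assumes "a \<le> b" "\<And>x. a \<le> x \<Longrightarrow> x \<le> b \<Longrightarrow> (f has_real_derivative f' x) (at x)"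
    "\<And>x. a \<le> x \<Longrightarrow> x \<le> b \<Longrightarrow> f' x \<ge> 0"
  shows "f a \<le> f b"
  using assms by (intro DERIV_nonneg_imp_nondecreasing[of a b f]) blast+

section \<open>Expansion away from the neutral fixed point\<close>

locale neutral_cantor_map =
  fixes F F' F'' :: "real \<Rightarrow> real" and b :: real and d :: nat
  assumes F_deriv: "\<And>x. (F has_real_derivative F' x) (at x)"
    and F'_deriv: "\<And>x. (F' has_real_derivative F'' x) (at x)"
    and F''_cont: "continuous_on UNIV F''"
    and F_0: "F 0 = 0" and F'_0: "F' 0 = 1" and F''_0: "F'' 0 > 0"
    and b: "0 < b" "b < 1" and F_b: "F b = b + real d - 1"
    and expanding: "\<And>x. 0 < x \<Longrightarrow> x \<le> b \<Longrightarrow> F' x > 1"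
begin

lemma F'_cont: "continuous_on S F'"
  using F'_deriv by (meson DERIV_continuous_on has_field_derivative_at_within)

lemma F_cont: "continuous_on S F"
  using F_deriv by (meson DERIV_continuous_on has_field_derivative_at_within)

lemma near_zero:
  obtains \<delta> e where "0 < \<delta>" "\<delta> \<le> b" "e > 0"
    "\<And>t. 0 \<le> t \<Longrightarrow> t \<le> \<delta> \<Longrightarrow> F'' t \<ge> e" "\<And>t. 0 \<le> t \<Longrightarrow> t \<le> \<delta> \<Longrightarrow> F' t \<le> 2"
proof -
  define e where "e = F'' 0 / 2"
  have e: "e > 0" using F''_0 by (simp add: e_def)
  have cont: "isCont F'' 0" "isCont F' 0"
    using F''_cont F'_cont[of UNIV] by (auto simp: continuous_on_eq_continuous_at)
  obtain d1 d2 where d1: "d1 > 0" "\<And>t. dist t 0 < d1 \<Longrightarrow> dist (F'' t) (F'' 0) < e"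
     and d2: "d2 > 0" "\<And>t. dist t 0 < d2 \<Longrightarrow> dist (F' t) (F' 0) < 1"
  proof -
    obtain d1 where "d1 > 0" "\<forall>t. dist t 0 < d1 \<longrightarrow> dist (F'' t) (F'' 0) < e"
      using cont(1) e unfolding continuous_at_eps_delta by blast
    moreover obtain d2 where "d2 > 0" "\<forall>t. dist t 0 < d2 \<longrightarrow> dist (F' t) (F' 0) < 1"
      using cont(2) zero_less_one unfolding continuous_at_eps_delta by blast
    ultimately show thesis using that by blast
  qed
  show thesis
  proof (rule that[of "min b (min (d1/2) (d2/2))" e])
    fix t assume t: "0 \<le> t" "t \<le> min b (min (d1/2) (d2/2))"
    then have "dist t 0 < d1" "dist t 0 < d2" using d1(1) d2(1) by (auto simp: dist_real_def)
    then have "\<bar>F'' t - F'' 0\<bar> < e" "\<bar>F' t - F' 0\<bar> < 1" using d1(2) d2(2) by (auto simp: dist_real_def)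
    then show "F'' t \<ge> e" "F' t \<le> 2" using F'_0 unfolding e_def by linarith+
  qed (use b e d1 d2 in auto)
qed

text \<open>On \<open>[0, \<delta>]\<close> the bound comes from \<open>F'' \<ge> e\<close>. On
  \<open>[\<delta>, b]\<close> the derivative attains a minimum above 1, and the factor
  \<open>m / b\<close> turns this constant excess into a linear one.\<close>

lemma F'_lower:
  obtains c where "c > 0" "\<And>t. 0 \<le> t \<Longrightarrow> t \<le> b \<Longrightarrow> F' t \<ge> 1 + c * t"
proof -
  obtain \<delta> e where \<delta>: "0 < \<delta>" "\<delta> \<le> b" and e: "e > 0"
    and F'': "\<And>t. 0 \<le> t \<Longrightarrow> t \<le> \<delta> \<Longrightarrow> F'' t \<ge> e"
    by (rule near_zero) blast
  have near: "F' t \<ge> 1 + e * t" if "0 \<le> t" "t \<le> \<delta>" for t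
  proof -
    have "F' 0 - e * 0 \<le> F' t - e * t"
      using that F'' by (intro DERIV_nonneg_le[of 0 t "\<lambda>x. F' x - e * x" "\<lambda>x. F'' x - e"])
        (auto intro!: derivative_eq_intros F'_deriv)
    then show ?thesis using F'_0 by simp
  qed
  have "\<exists>x\<in>{\<delta>..b}. \<forall>y\<in>{\<delta>..b}. F' x \<le> F' y"
    using \<delta> by (intro continuous_attains_inf F'_cont) auto
  then obtain x where x: "\<delta> \<le> x" "x \<le> b" "\<And>y. \<delta> \<le> y \<Longrightarrow> y \<le> b \<Longrightarrow> F' x \<le> F' y" by auto
  define m where "m = F' x - 1"
  have m: "m > 0" using expanding[of x] x \<delta> by (simp add: m_def)
  have far: "F' t \<ge> 1 + m / b * t" if "\<delta> \<le> t" "t \<le> b" for t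
  proof -
    have "m / b * t \<le> m / b * b" using m b that by (intro mult_left_mono) auto
    then show ?thesis using x(3)[OF that] b by (simp add: m_def)
  qed
  show thesis
  proof (rule that[of "min e (m / b)"])
    show "min e (m / b) > 0" using e m b by simp
    fix t assume t: "0 \<le> t" "t \<le> b"
    have "min e (m / b) * t \<le> e * t" "min e (m / b) * t \<le> m / b * t"
      using t by (simp_all only: mult_right_mono min.cobounded1 min.cobounded2)
    then show "F' t \<ge> 1 + min e (m / b) * t"
      using near[of t] far[of t] t by linarith
  qed
qed

text \<open>A fixed choice of the constant of \<open>F'_lower\<close>, to be shared by the
  statements that follow.\<close>

definition c :: real where
  "c = (SOME c. c > 0 \<and> (\<forall>t. 0 \<le> t \<longrightarrow> t \<le> b \<longrightarrow> F' t \<ge> 1 + c * t))"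

lemma c: "c > 0" "0 \<le> t \<Longrightarrow> t \<le> b \<Longrightarrow> F' t \<ge> 1 + c * t"
proof -
  have "\<exists>c. c > 0 \<and> (\<forall>t. 0 \<le> t \<longrightarrow> t \<le> b \<longrightarrow> F' t \<ge> 1 + c * t)"
    using F'_lower by blast
  from someI_ex[OF this] show "c > 0" "0 \<le> t \<Longrightarrow> t \<le> b \<Longrightarrow> F' t \<ge> 1 + c * t"
    unfolding c_def[symmetric] by auto
qed

lemma F'_ge_1: "0 \<le> t \<Longrightarrow> t \<le> b \<Longrightarrow> F' t \<ge> 1"
  using c(2)[of t] c(1) mult_nonneg_nonneg[of c t] by linarith

text \<open>Integrate \<open>F' t \<ge> 1 + c * t\<close> and use
  \<open>y^2 - x^2 \<ge> (y - x)^2\<close>. The gain depends only on the length of the interval, not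
  on its distance from the neutral point; this yields uniform shrinking of cylinders.\<close>

lemma F_expands:
  assumes "0 \<le> x" "x \<le> y" "y \<le> b"
  shows "F y - F x \<ge> (y - x) + c / 2 * (y - x)\<^sup>2"
proof -
  have "F x - x - c / 2 * x\<^sup>2 \<le> F y - y - c / 2 * y\<^sup>2"
  proof (rule DERIV_nonneg_le[of x y "\<lambda>u. F u - u - c / 2 * u\<^sup>2" "\<lambda>u. F' u - 1 - c * u"])
    show "0 \<le> F' u - 1 - c * u" if "x \<le> u" "u \<le> y" for u using c(2)[of u] that assms by simp
  qed (use assms in \<open>auto intro!: derivative_eq_intros F_deriv\<close>)
  moreover have "c / 2 * (y - x)\<^sup>2 \<le> c / 2 * (y\<^sup>2 - x\<^sup>2)"
  proof (intro mult_left_mono)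
    have "y\<^sup>2 - x\<^sup>2 - (y - x)\<^sup>2 = 2 * (x * (y - x))" by (simp add: power2_eq_square algebra_simps)
    then show "(y - x)\<^sup>2 \<le> y\<^sup>2 - x\<^sup>2" using assms mult_nonneg_nonneg[of x "y - x"] by linarith
  qed (use c in auto)
  ultimately show ?thesis by (simp add: algebra_simps)
qed

lemma c_square_nonneg: "0 \<le> c / 2 * z\<^sup>2"
  using c(1) by simp

lemma F_less: "0 \<le> x \<Longrightarrow> x < y \<Longrightarrow> y \<le> b \<Longrightarrow> F x < F y"
  using F_expands[of x y] c_square_nonneg[of "y - x"] by linarith

lemma F_le_iff: "0 \<le> x \<Longrightarrow> x \<le> b \<Longrightarrow> 0 \<le> y \<Longrightarrow> y \<le> b \<Longrightarrow> F x \<le> F y \<longleftrightarrow> x \<le> y"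
  using F_less[of x y] F_less[of y x] by (cases x y rule: linorder_cases) auto

lemma F_gt_self:
  assumes "0 < x" "x \<le> b"
  shows "F x > x"
proof -
  have "c / 2 * (x - 0)\<^sup>2 > 0" using assms c(1) by simp
  then show ?thesis using F_expands[of 0 x] F_0 assms by linarith
qed

lemma d_ge_2: "d \<ge> 2"
  using F_gt_self[of b] b F_b by linarith

section \<open>Inverse branches\<close>

definition branch :: "nat \<Rightarrow> real \<Rightarrow> real" where
  "branch j t = (THE x. 0 \<le> x \<and> x \<le> b \<and> F x = t + real j)"

lemma branch_eqI: "0 \<le> x \<Longrightarrow> x \<le> b \<Longrightarrow> F x = t + real j \<Longrightarrow> branch j t = x"
  unfolding branch_def
proof (rule the_equality)
  fix y assume "0 \<le> x" "x \<le> b" "F x = t + real j" "0 \<le> y \<and> y \<le> b \<and> F y = t + real j"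
  then show "y = x" using F_le_iff[of x y] F_le_iff[of y x] by simp
qed auto

lemma branch:
  assumes "j < d" "0 \<le> t" "t \<le> b"
  shows "0 \<le> branch j t" "branch j t \<le> b" "F (branch j t) = t + real j"
proof -
  have "real j \<le> real d - 1" using assms(1) by linarith
  then have "\<exists>x\<ge>0. x \<le> b \<and> F x = t + real j"
    using assms b F_0 F_b F_cont by (intro IVT') auto
  then show "0 \<le> branch j t" "branch j t \<le> b" "F (branch j t) = t + real j"
    using branch_eqI by auto
qed

lemma branch_less:
  "j < d \<Longrightarrow> 0 \<le> x \<Longrightarrow> x < y \<Longrightarrow> y \<le> b \<Longrightarrow> branch j x < branch j y"
  using branch[of j x] branch[of j y] F_le_iff[of "branch j y" "branch j x"] by force

lemma branch_0_0: "branch 0 0 = 0"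
  using b F_0 by (intro branch_eqI) auto

lemma branch_pos: "j < d \<Longrightarrow> 0 \<le> t \<Longrightarrow> t \<le> b \<Longrightarrow> j \<noteq> 0 \<or> t > 0 \<Longrightarrow> branch j t > 0"
  using branch[of j t] F_0 by (cases "branch j t = 0") auto

text \<open>\<open>F\<close> sends the two points to \<open>b + j\<close> and \<open>j + 1\<close>,
  and \<open>b < 1\<close>. These gaps are what the length estimates exploit.\<close>

lemma branch_gap: "Suc j < d \<Longrightarrow> branch j b < branch (Suc j) 0"
  using branch[of j b] branch[of "Suc j" 0] b F_le_iff[of "branch (Suc j) 0" "branch j b"] by force

fun branches :: "nat list \<Rightarrow> real \<Rightarrow> real" where
  "branches [] t = t"
| "branches (j # w) t = branch j (branches w t)"

lemma branches_append: "branches (u @ w) t = branches u (branches w t)"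
  by (induction u) auto

lemma branches_range:
  "set w \<subseteq> {..<d} \<Longrightarrow> 0 \<le> t \<Longrightarrow> t \<le> b \<Longrightarrow> 0 \<le> branches w t \<and> branches w t \<le> b"
  by (induction w) (auto simp: branch)

lemma branches_less:
  "set w \<subseteq> {..<d} \<Longrightarrow> 0 \<le> x \<Longrightarrow> x < y \<Longrightarrow> y \<le> b \<Longrightarrow> branches w x < branches w y"
proof (induction w)
  case (Cons j w)
  then show ?case using branches_range[of w x] branches_range[of w y] by (auto intro!: branch_less)
qed simp

lemma branches_mono:
  "set w \<subseteq> {..<d} \<Longrightarrow> 0 \<le> x \<Longrightarrow> x \<le> y \<Longrightarrow> y \<le> b \<Longrightarrow> branches w x \<le> branches w y"
  using branches_less[of w x y] by (cases "x = y") auto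

section \<open>Distortion along words\<close>

definition \<psi> :: "real \<Rightarrow> real" where "\<psi> x = ln (F' x)"

text \<open>The derivative \<open>F'' / F'\<close> is continuous on the compact interval, where
  \<open>F' \<ge> 1\<close>, hence bounded.\<close>

lemma \<psi>_lipschitz:
  obtains K where "K > 0" "\<And>x y. 0 \<le> x \<Longrightarrow> x \<le> b \<Longrightarrow> 0 \<le> y \<Longrightarrow> y \<le> b \<Longrightarrow> \<bar>\<psi> x - \<psi> y\<bar> \<le> K * \<bar>x - y\<bar>"
proof -
  have "continuous_on {0..b} (\<lambda>x. F'' x / F' x)"
    using F'_ge_1 by (intro continuous_intros F'_cont continuous_on_subset[OF F''_cont]) force+
  then have "bounded ((\<lambda>x. F'' x / F' x) ` {0..b})"
    by (intro compact_imp_bounded compact_continuous_image) auto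
  then obtain K where K: "K > 0" "\<And>x. x \<in> {0..b} \<Longrightarrow> norm (F'' x / F' x) \<le> K"
    unfolding bounded_pos by auto
  have "norm (\<psi> x - \<psi> y) \<le> K * norm (x - y)" if "x \<in> {0..b}" "y \<in> {0..b}" for x y
  proof (rule field_differentiable_bound[of "{0..b}"])
    fix z assume z: "z \<in> {0..b}"
    then have "F' z > 0" using F'_ge_1[of z] by auto
    then show "(\<psi> has_field_derivative F'' z / F' z) (at z within {0..b})"
      unfolding \<psi>_def by (auto intro!: derivative_eq_intros has_field_derivative_at_within[OF F'_deriv])
  qed (use that K in auto)
  then show thesis using K(1) that[of K] by auto
qed

definition K :: real where
  "K = (SOME K. K > 0 \<and> (\<forall>x y. 0 \<le> x \<longrightarrow> x \<le> b \<longrightarrow> 0 \<le> y \<longrightarrow> y \<le> b \<longrightarrow> \<bar>\<psi> x - \<psi> y\<bar> \<le> K * \<bar>x - y\<bar>))"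

lemma K: "K > 0" "0 \<le> x \<Longrightarrow> x \<le> b \<Longrightarrow> 0 \<le> y \<Longrightarrow> y \<le> b \<Longrightarrow> \<bar>\<psi> x - \<psi> y\<bar> \<le> K * \<bar>x - y\<bar>"
proof -
  have "\<exists>K. K > 0 \<and> (\<forall>x y. 0 \<le> x \<longrightarrow> x \<le> b \<longrightarrow> 0 \<le> y \<longrightarrow> y \<le> b \<longrightarrow> \<bar>\<psi> x - \<psi> y\<bar> \<le> K * \<bar>x - y\<bar>)"
  proof (rule \<psi>_lipschitz)
    fix K assume "K > 0" "\<And>x y. 0 \<le> x \<Longrightarrow> x \<le> b \<Longrightarrow> 0 \<le> y \<Longrightarrow> y \<le> b \<Longrightarrow> \<bar>\<psi> x - \<psi> y\<bar> \<le> K * \<bar>x - y\<bar>"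
    then show ?thesis by (intro exI[of _ K]) simp
  qed
  from someI_ex[OF this] show "K > 0" "0 \<le> x \<Longrightarrow> x \<le> b \<Longrightarrow> 0 \<le> y \<Longrightarrow> y \<le> b \<Longrightarrow> \<bar>\<psi> x - \<psi> y\<bar> \<le> K * \<bar>x - y\<bar>"
    unfolding K_def[symmetric] by auto
qed

text \<open>The Birkhoff sum of \<open>\<psi>\<close> over the orbit segment that follows
  \<open>w\<close> and ends at \<open>t\<close>; the end point itself is not counted.\<close>

fun birkhoff :: "nat list \<Rightarrow> real \<Rightarrow> real" where
  "birkhoff [] t = 0"
| "birkhoff (j # w) t = \<psi> (branches (j # w) t) + birkhoff w t"

definition len :: "nat list \<Rightarrow> real \<Rightarrow> real \<Rightarrow> real" where
  "len w x y = branches w y - branches w x"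

text \<open>The sum of the lengths of all pullbacks of \<open>[x, y]\<close> along the suffixes of
  the word, without \<open>[x, y]\<close> itself. It controls the distortion.\<close>

fun total_len :: "nat list \<Rightarrow> real \<Rightarrow> real \<Rightarrow> real" where
  "total_len [] x y = 0"
| "total_len (j # w) x y = len (j # w) x y + total_len w x y"

lemma len_pos: "set w \<subseteq> {..<d} \<Longrightarrow> 0 \<le> x \<Longrightarrow> x < y \<Longrightarrow> y \<le> b \<Longrightarrow> len w x y > 0"
  by (simp add: len_def branches_less)

lemma len_le_b: "set w \<subseteq> {..<d} \<Longrightarrow> 0 \<le> x \<Longrightarrow> x \<le> y \<Longrightarrow> y \<le> b \<Longrightarrow> len w x y \<le> b"
  using branches_range[of w x] branches_range[of w y] by (simp add: len_def)

lemma len_mono: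
  assumes "set w \<subseteq> {..<d}" "0 \<le> x" "x \<le> x'" "x' \<le> y'" "y' \<le> y" "y \<le> b"
  shows "len w x' y' \<le> len w x y"
  using branches_mono[of w x x'] branches_mono[of w y' y] assms by (simp add: len_def)

lemma total_len_mono:
  assumes "set w \<subseteq> {..<d}" "0 \<le> x" "x \<le> x'" "x' \<le> y'" "y' \<le> y" "y \<le> b"
  shows "total_len w x' y' \<le> total_len w x y"
  using assms
proof (induction w)
  case (Cons j w)
  then show ?case using len_mono[of "j # w" x x' y' y] by auto
qed simp

lemma total_len_snoc:
  "total_len (u @ [j]) x y = total_len u (branch j x) (branch j y) + (branch j y - branch j x)"
  by (induction u) (auto simp: len_def branches_append)

text \<open>By the mean value theorem each step changes the logarithm of the length by exactly
  \<open>\<psi> \<xi>\<close> for some \<open>\<xi>\<close> in the pulled-back interval. Replacing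
  \<open>\<xi>\<close> by the orbit point costs at most \<open>K\<close> times the length of that
  interval.\<close>

lemma ln_len_distortion:
  assumes "set w \<subseteq> {..<d}" "0 \<le> x" "x < y" "y \<le> b" "x \<le> t" "t \<le> y"
  shows "\<bar>ln (len w x y) - ln (y - x) + birkhoff w t\<bar> \<le> K * total_len w x y"
  using assms
proof (induction w)
  case Nil
  then show ?case by (simp add: len_def)
next
  case (Cons j w)
  let ?w = "j # w"
  have IH: "\<bar>ln (len w x y) - ln (y - x) + birkhoff w t\<bar> \<le> K * total_len w x y"
    using Cons by auto
  have w: "set w \<subseteq> {..<d}" and j: "j < d" using Cons.prems by auto
  have pos: "len ?w x y > 0" "len w x y > 0"
    using len_pos[of ?w x y] len_pos[of w x y] Cons.prems by auto
  have rx: "0 \<le> branches ?w x" and ry: "branches ?w y \<le> b"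
    using branches_range[of ?w x] branches_range[of ?w y] Cons.prems by auto
  have "branches ?w x < branches ?w y" using pos(1) by (simp add: len_def)
  then obtain \<xi> where \<xi>: "branches ?w x < \<xi>" "\<xi> < branches ?w y"
      "F (branches ?w y) - F (branches ?w x) = (branches ?w y - branches ?w x) * F' \<xi>"
    using MVT2[of "branches ?w x" "branches ?w y" F F'] F_deriv by auto
  have "F (branches ?w y) = branches w y + real j" "F (branches ?w x) = branches w x + real j"
    using branch(3)[OF j] branches_range[OF w, of x] branches_range[OF w, of y] Cons.prems by auto
  then have "len w x y = len ?w x y * F' \<xi>" using \<xi>(3) by (simp add: len_def)
  moreover have "F' \<xi> > 0" using F'_ge_1[of \<xi>] \<xi> rx ry by linarith
  ultimately have ln_eq: "ln (len w x y) = ln (len ?w x y) + \<psi> \<xi>"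
    using pos by (simp add: ln_mult \<psi>_def)
  have t: "branches ?w x \<le> branches ?w t" "branches ?w t \<le> branches ?w y"
    using branches_mono[of ?w x t] branches_mono[of ?w t y] Cons.prems by auto
  have "\<bar>\<psi> (branches ?w t) - \<psi> \<xi>\<bar> \<le> K * \<bar>branches ?w t - \<xi>\<bar>"
    using t \<xi> rx ry by (intro K) auto
  also have "\<dots> \<le> K * len ?w x y"
    using t \<xi> K(1) by (intro mult_left_mono) (auto simp: len_def)
  finally show ?case using IH ln_eq by (simp add: algebra_simps abs_le_iff)
qed

section \<open>Uniform shrinking of cylinders\<close>

text \<open>Going forward, every step adds at least \<open>c / 2\<close> times the square of the
  current length. Lengths only grow forward, so each of these gains is at least the one computed
  from the initial interval.\<close>

lemma len_shrinks:
  assumes "set w \<subseteq> {..<d}" "0 \<le> x" "x \<le> y" "y \<le> b"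
  shows "len w x y + real (length w) * (c / 2 * (len w x y)\<^sup>2) \<le> y - x"
  using assms
proof (induction w)
  case (Cons j w)
  let ?l = "len (j # w) x y" and ?l' = "len w x y"
  have w: "set w \<subseteq> {..<d}" and j: "j < d" using Cons.prems by auto
  have r: "0 \<le> branches w x" "branches w x \<le> b" "0 \<le> branches w y" "branches w y \<le> b"
    using branches_range[OF w] Cons.prems by auto
  have "(branches (j # w) y - branches (j # w) x) + c / 2 * (branches (j # w) y - branches (j # w) x)\<^sup>2
      \<le> F (branches (j # w) y) - F (branches (j # w) x)"
    using branches_range[of "j # w" x] branches_range[of "j # w" y] branches_mono[of "j # w" x y] Cons.prems
    by (intro F_expands) auto
  then have step: "?l + c / 2 * ?l\<^sup>2 \<le> ?l'"
    using branch(3)[OF j r(1,2)] branch(3)[OF j r(3,4)] by (simp add: len_def)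
  have l0: "0 \<le> ?l" using branches_mono[of "j # w" x y] Cons.prems by (simp add: len_def)
  have "?l \<le> ?l'" using step c_square_nonneg[of ?l] by linarith
  then have "?l\<^sup>2 \<le> ?l'\<^sup>2" using l0 by (intro power_mono)
  then have "real (length w) * (c / 2 * ?l\<^sup>2) \<le> real (length w) * (c / 2 * ?l'\<^sup>2)"
    using c(1) by (intro mult_left_mono) auto
  moreover have "?l' + real (length w) * (c / 2 * ?l'\<^sup>2) \<le> y - x" using Cons w by blast
  moreover have "real (length (j # w)) * (c / 2 * ?l\<^sup>2) = c / 2 * ?l\<^sup>2 + real (length w) * (c / 2 * ?l\<^sup>2)"
    by (simp add: algebra_simps)
  ultimately show ?case using step by linarith
qed (simp add: len_def)

lemma len_uniformly_small:
  assumes "e > 0"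
  obtains N where "\<And>w. set w \<subseteq> {..<d} \<Longrightarrow> length w \<ge> N \<Longrightarrow> len w 0 b \<le> e"
proof -
  obtain N where N: "real N > b / (c / 2 * e\<^sup>2)" using reals_Archimedean2 by blast
  have "len w 0 b \<le> e" if w: "set w \<subseteq> {..<d}" "length w \<ge> N" for w
  proof (rule ccontr)
    assume *: "\<not> len w 0 b \<le> e"
    then have "e\<^sup>2 \<le> (len w 0 b)\<^sup>2" using assms by (intro power_mono) auto
    then have "real N * (c / 2 * e\<^sup>2) \<le> real (length w) * (c / 2 * (len w 0 b)\<^sup>2)"
      using w c(1) by (intro mult_mono) auto
    also have "\<dots> \<le> b" using len_shrinks[OF w(1), of 0 b] b * assms by simp
    finally show False using N c(1) assms by (simp add: field_simps)
  qed
  then show thesis by (rule that)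
qed

text \<open>Only suffixes shorter than \<open>N\<close> can have cylinders longer than
  \<open>e\<close>, and each of these has length at most \<open>b\<close>. Distortion is therefore
  sublinear in the length of the word.\<close>

lemma total_len_sublinear:
  assumes "e > 0"
  obtains C where "\<And>w. set w \<subseteq> {..<d} \<Longrightarrow> total_len w 0 b \<le> C + e * real (length w)"
proof -
  obtain N where N: "\<And>w. set w \<subseteq> {..<d} \<Longrightarrow> length w \<ge> N \<Longrightarrow> len w 0 b \<le> e"
    using len_uniformly_small[OF assms] by blast
  have "total_len w 0 b \<le> b * real (min (length w) N) + e * real (length w)" if "set w \<subseteq> {..<d}" for w
    using that
  proof (induction w)
    case (Cons j w)
    have "len (j # w) 0 b \<le> b" using len_le_b[of "j # w" 0 b] Cons.prems b by auto
    moreover have "len (j # w) 0 b \<le> e" if "Suc (length w) \<ge> N" using N[of "j # w"] Cons.prems that by auto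
    moreover have "total_len w 0 b \<le> b * real (min (length w) N) + e * real (length w)"
      using Cons by simp
    ultimately show ?case using assms
      by (cases "Suc (length w) \<le> N") (simp_all add: min_absorb1 min_absorb2 algebra_simps)
  qed simp
  moreover have "b * real (min (length w) N) \<le> b * real N" for w :: "nat list" using b by auto
  ultimately show thesis by (intro that[of "b * real N"]) (meson add_right_mono order_trans)
qed

text \<open>The density \<open>1/t + A\<close> grows along orbits by at least \<open>c\<^sub>0\<close> per step: near the neutral
  point because of \<open>1/t\<close>, elsewhere by expansion.  Hence the total length of the orbit of an interval
  is controlled by its final position alone.\<close>

lemma adapted_density:
  obtains A c\<^sub>0 where "A \<ge> 0" "c\<^sub>0 > 0"
    "\<And>u. 0 < u \<Longrightarrow> u \<le> b \<Longrightarrow> F' u / F u - 1 / u + A * (F' u - 1) \<ge> c\<^sub>0"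
proof -
  obtain \<delta> e where \<delta>: "0 < \<delta>" "\<delta> \<le> b" and e: "e > 0"
    and F'': "\<And>t. 0 \<le> t \<Longrightarrow> t \<le> \<delta> \<Longrightarrow> F'' t \<ge> e"
    and F'2: "\<And>t. 0 \<le> t \<Longrightarrow> t \<le> \<delta> \<Longrightarrow> F' t \<le> 2"
    by (rule near_zero) blast
  \<comment> \<open>Chosen so that \<open>A * (c * \<delta>) = 1 + 1 / \<delta>\<close>: for
    \<open>u > \<delta>\<close> the expansion then outweighs \<open>- 1 / u\<close> and leaves at
    least 1.\<close>
  define A where "A = (1 + 1 / \<delta>) / (c * \<delta>)"
  have A: "A \<ge> 0" using \<delta> c(1) by (simp add: A_def)
  define c\<^sub>0 where "c\<^sub>0 = min (e / 4) 1"
  show thesis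
  proof (rule that[OF A, of c\<^sub>0])
    show "c\<^sub>0 > 0" using e by (simp add: c\<^sub>0_def)
    fix u assume u: "0 < u" "u \<le> b"
    have Fu: "F u > 0" using F_gt_self[OF u] u by simp
    have F'u: "F' u \<ge> 1" using F'_ge_1 u by simp
    show "F' u / F u - 1 / u + A * (F' u - 1) \<ge> c\<^sub>0"
    proof (cases "u \<le> \<delta>")
      case True
      \<comment> \<open>Near zero the numerator of \<open>F' u / F u - 1 / u\<close> is at least
        \<open>e / 2 * u^2\<close>, while its denominator \<open>u * F u\<close> is at most
        \<open>2 * u^2\<close>; this gives the constant \<open>e / 4\<close>.\<close>
      have "0 * F' 0 - F 0 - e / 2 * 0\<^sup>2 \<le> u * F' u - F u - e / 2 * u\<^sup>2"
      proof (rule DERIV_nonneg_le[of 0 u "\<lambda>u. u * F' u - F u - e / 2 * u\<^sup>2" "\<lambda>x. x * F'' x - e * x"])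
        show "0 \<le> x * F'' x - e * x" if "0 \<le> x" "x \<le> u" for x
          using F''[of x] True that mult_left_mono[of e "F'' x" x] by (simp add: mult.commute)
      qed (use u in \<open>auto intro!: derivative_eq_intros F_deriv F'_deriv\<close>)
      then have low: "e / 2 * u\<^sup>2 \<le> u * F' u - F u" using F_0 by simp
      have "2 * 0 - F 0 \<le> 2 * u - F u"
        using u True F'2 by (intro DERIV_nonneg_le[of 0 u "\<lambda>x. 2 * x - F x" "\<lambda>x. 2 - F' x"])
          (auto intro!: derivative_eq_intros F_deriv)
      then have "F u \<le> 2 * u" using F_0 by simp
      then have "e / 4 * (u * F u) \<le> e / 4 * (u * (2 * u))"
        using e u by (intro mult_left_mono) auto
      also have "\<dots> \<le> u * F' u - F u" using low by (simp add: power2_eq_square)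
      finally have "e / 4 \<le> F' u / F u - 1 / u"
        using u Fu by (simp add: field_simps)
      moreover have "A * (F' u - 1) \<ge> 0" using A F'u by simp
      ultimately show ?thesis unfolding c\<^sub>0_def by linarith
    next
      case False
      have "c * \<delta> \<le> c * u" using False c(1) by simp
      also have "\<dots> \<le> F' u - 1" using c(2)[of u] u by simp
      finally have "A * (F' u - 1) \<ge> A * (c * \<delta>)" using A by (intro mult_left_mono)
      also have "A * (c * \<delta>) = 1 + 1 / \<delta>" using c(1) \<delta> by (simp add: A_def)
      finally have "A * (F' u - 1) \<ge> 1 + 1 / \<delta>" .
      moreover have "1 / u \<le> 1 / \<delta>" using False \<delta> by (simp add: frac_le)
      moreover have "F' u / F u \<ge> 0" using F'u Fu by simp
      ultimately show ?thesis by (simp add: c\<^sub>0_def)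
    qed
  qed
qed

text \<open>\<open>L\<close> is a primitive of the adapted density. Each inverse branch lowers the
  \<open>L\<close>-length by at least \<open>c\<^sub>0\<close> times the new length, so the total
  length telescopes to the \<open>L\<close>-length of the starting interval. A nonzero last letter
  keeps that interval in \<open>[branch 1 0, b]\<close>, away from the singularity of
  \<open>L\<close> at 0.\<close>

lemma total_len_away_from_zero:
  obtains D where "\<And>u j. set (u @ [j]) \<subseteq> {..<d} \<Longrightarrow> j \<noteq> 0 \<Longrightarrow> total_len (u @ [j]) 0 b \<le> D"
proof -
  obtain A c\<^sub>0 where A: "A \<ge> 0" and c\<^sub>0: "c\<^sub>0 > 0"
    and grow: "\<And>u. 0 < u \<Longrightarrow> u \<le> b \<Longrightarrow> F' u / F u - 1 / u + A * (F' u - 1) \<ge> c\<^sub>0"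
    using adapted_density by blast
  define L where "L t = ln t + A * t" for t
  have L_mono: "L x \<le> L y" if "0 < x" "x \<le> y" for x y
    unfolding L_def using that A by (intro add_mono mult_left_mono) auto
  have step: "L (branch j y) - L (branch j x) + c\<^sub>0 * (branch j y - branch j x) \<le> L y - L x"
    if "j < d" "0 < x" "x \<le> y" "y \<le> b" for j x y
  proof -
    let ?x = "branch j x" and ?y = "branch j y"
    have bx: "0 < ?x" "F ?x = x + real j" "?x \<le> b" and by': "?y \<le> b" "F ?y = y + real j"
      using branch[of j x] branch[of j y] branch_pos[of j x] that by auto
    have xy: "?x \<le> ?y" using branch_less[of j x y] that by (cases "x = y") auto
    have "L (F ?x - real j) - L ?x - c\<^sub>0 * ?x \<le> L (F ?y - real j) - L ?y - c\<^sub>0 * ?y"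
    proof (rule DERIV_nonneg_imp_nondecreasing[OF xy])
      fix u assume u: "?x \<le> u" "u \<le> ?y"
      then have u0: "u > 0" "u \<le> b" using bx by' by auto
      have Fu: "F u - real j > 0" using F_le_iff[of ?x u] bx u u0 that(2) by auto
      have F'u: "F' u \<ge> 1" using F'_ge_1 u0 by simp
      \<comment> \<open>Subtracting the integer \<open>j\<close> moves the image closer to 0, where
        the density is only larger; so \<open>grow\<close> covers every branch.\<close>
      have "F' u / F u \<le> F' u / (F u - real j)" using Fu F'u by (intro divide_left_mono) auto
      then have "(1 / (F u - real j) + A) * F' u - 1 / u - A - c\<^sub>0 \<ge> 0"
        using grow[OF u0] by (simp add: algebra_simps)
      moreover have "((\<lambda>u. L (F u - real j) - L u - c\<^sub>0 * u) has_real_derivative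
          (1 / (F u - real j) + A) * F' u - 1 / u - A - c\<^sub>0) (at u)"
        unfolding L_def using Fu u0
        by (auto intro!: derivative_eq_intros F_deriv simp: field_simps)
      ultimately show "\<exists>D. ((\<lambda>u. L (F u - real j) - L u - c\<^sub>0 * u) has_real_derivative D) (at u) \<and> 0 \<le> D"
        by blast
    qed
    then show ?thesis using bx by' by (simp add: algebra_simps)
  qed
  have sum: "c\<^sub>0 * total_len u x y \<le> (L y - L x) - (L (branches u y) - L (branches u x)) \<and> 0 < branches u x"
    if "set u \<subseteq> {..<d}" "0 < x" "x \<le> y" "y \<le> b" for u x y
    using that
  proof (induction u)
    case (Cons j u)
    have r: "0 < branches u x" "branches u x \<le> branches u y" "branches u y \<le> b"
      using Cons branches_mono[of u x y] branches_range[of u y] by auto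
    have "j < d" using Cons.prems by auto
    with step[OF this r] branch_pos[of j "branches u x"] r Cons show ?case
      by (auto simp: len_def algebra_simps)
  qed simp
  have total: "c\<^sub>0 * total_len u x y \<le> L y - L x" if "set u \<subseteq> {..<d}" "0 < x" "x \<le> y" "y \<le> b" for u x y
    using sum[OF that] L_mono[of "branches u x" "branches u y"] branches_mono[of u x y] that by auto
  \<comment> \<open>The summand \<open>b\<close> pays for the interval of the last letter, which
    \<open>total_len_snoc\<close> splits off.\<close>
  define D where "D = (L b - L (branch 1 0)) / c\<^sub>0 + b"
  have "total_len (u @ [j]) 0 b \<le> D" if u: "set (u @ [j]) \<subseteq> {..<d}" and j: "j \<noteq> 0" for u j
  proof -
    have jd: "j < d" using u by auto
    have r: "0 < branch 1 0" "branch 1 0 \<le> branch j 0" "branch j 0 \<le> branch j b" "branch j b \<le> b"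
    proof -
      show "0 < branch 1 0" using d_ge_2 b by (intro branch_pos) auto
      show "branch 1 0 \<le> branch j 0"
        using branch[of 1 0] branch[of j 0] jd j b d_ge_2 F_le_iff[of "branch 1 0" "branch j 0"] by auto
      show "branch j 0 \<le> branch j b" using branch_less[of j 0 b] jd b by auto
      show "branch j b \<le> b" using branch[of j b] jd b by auto
    qed
    have "c\<^sub>0 * total_len u (branch j 0) (branch j b) \<le> L (branch j b) - L (branch j 0)"
      using u r by (intro total) auto
    also have "\<dots> \<le> L b - L (branch 1 0)"
      using L_mono[of "branch 1 0" "branch j 0"] L_mono[of "branch j b" b] r by auto
    finally have "total_len u (branch j 0) (branch j b) \<le> (L b - L (branch 1 0)) / c\<^sub>0"
      using c\<^sub>0 by (simp add: field_simps)
    then show ?thesis using r by (simp add: total_len_snoc D_def)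
  qed
  then show thesis by (rule that)
qed

section \<open>Loss of length to the gaps\<close>

text \<open>The whole interval and the gap are compared with the Birkhoff sum at their common point
  \<open>branch 0 b\<close>. For words ending in a nonzero letter both distortion errors are at most
  \<open>K * D\<close>, so the ratio of the two lengths is bounded below.\<close>

lemma gap_proportion:
  obtains \<theta> where "0 < \<theta>" "\<theta> < 1"
    "\<And>u j. set (u @ [j]) \<subseteq> {..<d} \<Longrightarrow> j \<noteq> 0 \<Longrightarrow>
       len (u @ [j]) (branch 0 b) (branch 1 0) \<ge> \<theta> * len (u @ [j]) 0 b"
proof -
  obtain D where D: "\<And>u j. set (u @ [j]) \<subseteq> {..<d} \<Longrightarrow> j \<noteq> 0 \<Longrightarrow> total_len (u @ [j]) 0 b \<le> D"
    using total_len_away_from_zero by blast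
  let ?g = "branch 0 b" and ?h = "branch 1 0"
  have gh: "0 < ?g" "?g < ?h" "?h \<le> b"
    using branch_pos[of 0 b] branch_gap[of 0] branch[of 1 0] d_ge_2 b by auto
  define \<eta> where "\<eta> = ln (?h - ?g) - ln b - 2 * K * D"
  have "len (u @ [j]) ?g ?h \<ge> exp \<eta> * len (u @ [j]) 0 b"
    if u: "set (u @ [j]) \<subseteq> {..<d}" "j \<noteq> 0" for u j
  proof -
    let ?w = "u @ [j]"
    have pos: "len ?w ?g ?h > 0" "len ?w 0 b > 0"
      using len_pos[OF u(1)] gh b by auto
    have le: "total_len ?w ?g ?h \<le> total_len ?w 0 b"
      using gh by (intro total_len_mono[OF u(1)]) auto
    have "K * total_len ?w 0 b \<le> K * D" "K * total_len ?w ?g ?h \<le> K * D"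
      using D[OF u] le K(1) by (auto intro!: mult_left_mono)
    moreover have "\<bar>ln (len ?w ?g ?h) - ln (?h - ?g) + birkhoff ?w ?g\<bar> \<le> K * total_len ?w ?g ?h"
      using gh by (intro ln_len_distortion[OF u(1)]) auto
    moreover have "\<bar>ln (len ?w 0 b) - ln (b - 0) + birkhoff ?w ?g\<bar> \<le> K * total_len ?w 0 b"
      using gh b by (intro ln_len_distortion[OF u(1)]) auto
    ultimately have "\<eta> + ln (len ?w 0 b) \<le> ln (len ?w ?g ?h)" by (simp add: \<eta>_def)
    then have "exp (\<eta> + ln (len ?w 0 b)) \<le> len ?w ?g ?h"
      using pos(1) by (simp add: ln_ge_iff)
    then show ?thesis using pos by (simp add: exp_add)
  qed
  moreover have "min (exp \<eta>) (1/2) * len (u @ [j]) 0 b \<le> exp \<eta> * len (u @ [j]) 0 b"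
    if "set (u @ [j]) \<subseteq> {..<d}" for u j
    using len_pos[OF that, of 0 b] b by (intro mult_right_mono) auto
  ultimately have "min (exp \<eta>) (1/2) * len (u @ [j]) 0 b \<le> len (u @ [j]) ?g ?h"
    if "set (u @ [j]) \<subseteq> {..<d}" "j \<noteq> 0" for u j
    using that order_trans by blast
  \<comment> \<open>The cap \<open>1/2\<close> guarantees \<open>\<theta> < 1\<close>, which
    \<open>ln (1 - \<theta>)\<close> will need.\<close>
  then show thesis by (intro that[of "min (exp \<eta>) (1/2)"]) auto
qed

text \<open>The subcylinders lie in order inside the cylinder of \<open>w\<close>. The induction on
  the number of branches, starting at 2, keeps the gap between branches 0 and 1 and discards the
  others.\<close>

lemma sum_len_snoc:
  assumes w: "set w \<subseteq> {..<d}"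
  shows "(\<Sum>j<d. len (w @ [j]) 0 b) \<le> len w 0 b - len w (branch 0 b) (branch 1 0)"
proof -
  have "2 \<le> r \<Longrightarrow> r \<le> d \<Longrightarrow> (\<Sum>j<r. len (w @ [j]) 0 b)
      \<le> branches w (branch (r - 1) b) - branches w 0 - len w (branch 0 b) (branch 1 0)" for r
  proof (induction r rule: nat_induct_at_least)
    case base
    show ?case by (simp add: numeral_2_eq_2 len_def branches_append branch_0_0)
  next
    case (Suc r)
    have "branches w (branch (r - 1) b) \<le> branches w (branch r 0)"
      using Suc.hyps Suc.prems b branch[of "r - 1" b] branch[of r 0] branch_gap[of "r - 1"]
      by (intro branches_mono[OF w]) auto
    with Suc show ?case by (simp add: len_def branches_append)
  qed
  from this[of d] have "(\<Sum>j<d. len (w @ [j]) 0 b)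
      \<le> branches w (branch (d - 1) b) - branches w 0 - len w (branch 0 b) (branch 1 0)"
    using d_ge_2 by simp
  moreover have "branches w (branch (d - 1) b) \<le> branches w b"
    using d_ge_2 b branch[of "d - 1" b] by (intro branches_mono[OF w]) auto
  ultimately show ?thesis by (simp add: len_def)
qed

definition visits :: "nat list \<Rightarrow> nat" where
  "visits w = length (filter (\<lambda>j. j \<noteq> 0) w)"

text \<open>With \<open>exp \<kappa> * (1 - \<theta>) = 1\<close>, the factor earned by a nonzero
  letter is exactly what its cylinder loses to the gap.\<close>

lemma weighted_len_sum:
  obtains \<kappa> Z where "\<kappa> > 0"
    "\<And>n. (\<Sum>w\<in>words {..<d} n. exp (\<kappa> * real (visits w)) * len w 0 b) \<le> Z"
proof -
  obtain \<theta> where \<theta>: "0 < \<theta>" "\<theta> < 1" and gap: "\<And>u j. set (u @ [j]) \<subseteq> {..<d} \<Longrightarrow> j \<noteq> 0 \<Longrightarrow>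
       len (u @ [j]) (branch 0 b) (branch 1 0) \<ge> \<theta> * len (u @ [j]) 0 b"
    using gap_proportion by blast
  define \<kappa> where "\<kappa> = - ln (1 - \<theta>)"
  have \<kappa>: "\<kappa> > 0" "exp \<kappa> * (1 - \<theta>) = 1" using \<theta> by (auto simp: \<kappa>_def exp_minus)
  let ?m = "\<lambda>w. exp (\<kappa> * real (visits w))"
  \<comment> \<open>The weight of \<open>w\<close> is paired with the lengths of its children,
    because the loss caused by a nonzero last letter shows only at the next subdivision. In this
    form the sums are nonincreasing.\<close>
  define U where "U n = (\<Sum>w\<in>words {..<d} n. ?m w * (\<Sum>j<d. len (w @ [j]) 0 b))" for n
  have snoc0: "(\<Sum>j<d. len (w @ [j]) 0 b) \<le> len w 0 b" if w: "set w \<subseteq> {..<d}" for w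
  proof -
    have "len w (branch 0 b) (branch 1 0) \<ge> 0"
      using len_pos[OF w, of "branch 0 b" "branch 1 0"] branch_gap[of 0] branch[of 0 b] branch[of 1 0] b d_ge_2
      by force
    then show ?thesis using sum_len_snoc[OF w] by simp
  qed
  have "U (Suc n) \<le> U n" for n
  proof -
    have "?m (w @ [k]) * (\<Sum>j<d. len ((w @ [k]) @ [j]) 0 b) \<le> ?m w * len (w @ [k]) 0 b"
      if w: "w \<in> words {..<d} n" and k: "k < d" for w k
    proof (cases "k = 0")
      case True
      have "set (w @ [k]) \<subseteq> {..<d}" using w k by (auto simp: words_def)
      from snoc0[OF this] show ?thesis using True by (simp add: visits_def)
    next
      case False
      have s: "set (w @ [k]) \<subseteq> {..<d}" using w k by (auto simp: words_def)
      have "(\<Sum>j<d. len ((w @ [k]) @ [j]) 0 b) \<le> (1 - \<theta>) * len (w @ [k]) 0 b"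
        using sum_len_snoc[OF s] gap[OF s False] by (simp add: algebra_simps)
      then have "?m (w @ [k]) * (\<Sum>j<d. len ((w @ [k]) @ [j]) 0 b)
          \<le> ?m (w @ [k]) * ((1 - \<theta>) * len (w @ [k]) 0 b)" by (intro mult_left_mono) auto
      also have "\<dots> = ?m w * exp \<kappa> * ((1 - \<theta>) * len (w @ [k]) 0 b)"
        using False by (simp add: visits_def exp_add algebra_simps)
      also have "\<dots> = ?m w * (exp \<kappa> * (1 - \<theta>)) * len (w @ [k]) 0 b"
        by (simp add: algebra_simps)
      finally show ?thesis unfolding \<kappa>(2) by simp
    qed
    then show ?thesis
      unfolding U_def sum_words_snoc sum_distrib_left by (intro sum_mono) (auto simp: sum_distrib_left)
  qed
  then have "U n \<le> U 0" for n by (induction n) (auto intro: order_trans)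
  moreover have "U 0 \<le> b" using snoc0[of "[]"] by (simp add: U_def visits_def len_def)
  ultimately have U: "U n \<le> b" for n using order_trans by blast
  \<comment> \<open>Compared with \<open>U\<close>, the weight here also counts the last letter,
    which costs at most one factor \<open>exp \<kappa>\<close>.\<close>
  have "(\<Sum>w\<in>words {..<d} n. ?m w * len w 0 b) \<le> exp \<kappa> * b" for n
  proof (cases n)
    case 0
    then show ?thesis using \<kappa>(1) b by (simp add: visits_def len_def)
  next
    case (Suc r)
    have "?m (w @ [k]) * len (w @ [k]) 0 b \<le> exp \<kappa> * (?m w * len (w @ [k]) 0 b)"
      if "w \<in> words {..<d} r" "k < d" for w k
    proof -
      have "len (w @ [k]) 0 b \<ge> 0" using len_pos[of "w @ [k]" 0 b] that b by (auto simp: words_def less_imp_le)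
      moreover have "?m (w @ [k]) \<le> exp \<kappa> * ?m w"
        using \<kappa>(1) by (auto simp: visits_def algebra_simps simp flip: exp_add)
      ultimately show ?thesis by (metis mult.assoc mult_right_mono)
    qed
    then have "(\<Sum>w\<in>words {..<d} n. ?m w * len w 0 b) \<le> exp \<kappa> * U r"
      unfolding Suc U_def sum_words_snoc sum_distrib_left by (intro sum_mono) auto
    also have "\<dots> \<le> exp \<kappa> * b" using U by simp
    finally show ?thesis .
  qed
  then show thesis using \<kappa>(1) that by blast
qed

end

section \<open>The entropy gap\<close>

lemma circle_sets_space:
  assumes "sets \<mu> = sets circle_borel"
  shows "space \<mu> = {0..<1}"
  using sets_eq_imp_space_eq[OF assms] by (simp add: circle_borel_def circle_space_def space_restrict_space)

lemma circle_borel_measurable: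
  fixes g :: "real \<Rightarrow> real"
  assumes "sets \<mu> = sets circle_borel" "g \<in> borel_measurable borel"
  shows "g \<in> borel_measurable \<mu>"
proof -
  have "g \<in> borel_measurable circle_borel"
    unfolding circle_borel_def by (rule measurable_restrict_space1[OF assms(2)])
  then show ?thesis using measurable_cong_sets[OF assms(1) refl] by blast
qed

lemma circle_sets_borel:
  assumes "sets \<mu> = sets circle_borel" "A \<in> sets \<mu>"
  shows "A \<in> sets borel"
  using assms by (auto simp: circle_borel_def circle_space_def sets_restrict_space_iff)

section \<open>Coding the support of the measure\<close>

locale neutral_cantor_system =
  neutral_cantor_map F F' F'' b d + measure_preserving_system \<mu> T
  for F F' F'' :: "real \<Rightarrow> real" and b :: real and d :: nat
    and \<mu> :: "real measure" and T :: "real \<Rightarrow> real" +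
  assumes T_def: "T = (\<lambda>t. frac (F t))"
    and sets_mu: "sets \<mu> = sets circle_borel" and supp: "AE x in \<mu>. x \<le> b"
begin

definition letter :: "real \<Rightarrow> nat" where "letter x = nat \<lfloor>F x\<rfloor>"

text \<open>Demanding the bound along the whole orbit turns the almost sure statement
  \<open>supp\<close> into a forward invariant set of full measure.\<close>

definition \<Lambda> :: "real set" where "\<Lambda> = {x \<in> space \<mu>. \<forall>n. (T ^^ n) x \<le> b}"

lemma space_mu: "space \<mu> = {0..<1}"
  by (rule circle_sets_space[OF sets_mu])

lemma F_measurable [measurable]: "F \<in> borel_measurable \<mu>" and F'_measurable [measurable]: "F' \<in> borel_measurable \<mu>"
  and id_measurable [measurable]: "(\<lambda>x. x) \<in> borel_measurable \<mu>"
  by (intro circle_borel_measurable[OF sets_mu] borel_measurable_continuous_onI F_cont F'_cont; simp)+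

lemma letter_measurable [measurable]: "letter \<in> \<mu> \<rightarrow>\<^sub>M count_space UNIV"
  unfolding letter_def by measurable

lemma \<Lambda>_sets: "\<Lambda> \<in> sets \<mu>"
proof -
  have "(T ^^ n) \<in> borel_measurable \<mu>" for n
    using measurable_comp[OF funpow_T_measurable[of n] id_measurable] by (simp add: comp_def)
  then show ?thesis unfolding \<Lambda>_def by measurable
qed

lemma \<Lambda>_AE: "AE x in \<mu>. x \<in> \<Lambda>"
proof -
  have "AE x in \<mu>. \<forall>n. (T ^^ n) x \<le> b"
    unfolding AE_all_countable by (intro allI AE_funpow supp)
  then show ?thesis using AE_space by eventually_elim (simp add: \<Lambda>_def)
qed

lemma \<Lambda>_range: "x \<in> \<Lambda> \<Longrightarrow> 0 \<le> x \<and> x \<le> b"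
  using space_mu funpow_0[of T x] unfolding \<Lambda>_def by (auto dest: spec[of _ 0])

lemma \<Lambda>_invariant:
  assumes "x \<in> \<Lambda>"
  shows "T x \<in> \<Lambda>"
proof -
  have "(T ^^ n) (T x) = (T ^^ Suc n) x" for n by (simp add: funpow_swap1)
  moreover have "\<forall>n. (T ^^ n) x \<le> b" "x \<in> space \<mu>" using assms by (simp_all add: \<Lambda>_def)
  ultimately have "\<forall>n. (T ^^ n) (T x) \<le> b" by metis
  then show ?thesis using T_space[OF \<open>x \<in> space \<mu>\<close>] by (simp add: \<Lambda>_def)
qed

lemma F_split:
  assumes "x \<in> \<Lambda>"
  shows "letter x < d" "F x = T x + real (letter x)" "branch (letter x) (T x) = x"
proof -
  note x = \<Lambda>_range[OF assms]
  have "0 \<le> F x" using F_le_iff[of 0 x] F_0 x b by auto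
  then show *: "F x = T x + real (letter x)" by (simp add: T_def letter_def frac_def)
  have "F x \<le> F b" using F_le_iff[of x b] x b by auto
  then have "real (letter x) < real d" 
  proof -
    have "0 \<le> T x" by (simp add: T_def)
    then show ?thesis using * F_b b \<open>F x \<le> F b\<close> by linarith
  qed
  then show "letter x < d" by simp
  show "branch (letter x) (T x) = x" using x * by (intro branch_eqI) auto
qed

lemma word_range: "x \<in> \<Lambda> \<Longrightarrow> set (word T letter n x) \<subseteq> {..<d}"
  by (induction n arbitrary: x) (auto simp: F_split(1) \<Lambda>_invariant)

lemma branches_word:
  "x \<in> \<Lambda> \<Longrightarrow> branches (word T letter n x) ((T ^^ n) x) = x"
proof (induction n arbitrary: x)
  case (Suc n)
  then show ?case using \<Lambda>_invariant[of x] F_split(3)[of x] by (simp add: funpow_swap1)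
qed simp

lemma birkhoff_word:
  "x \<in> \<Lambda> \<Longrightarrow> birkhoff (word T letter n x) ((T ^^ n) x) = (\<Sum>i<n. \<psi> ((T ^^ i) x))"
proof (induction n arbitrary: x)
  case (Suc n)
  have "birkhoff (word T letter (Suc n) x) ((T ^^ Suc n) x)
      = \<psi> (branches (word T letter (Suc n) x) ((T ^^ Suc n) x))
        + birkhoff (word T letter n (T x)) ((T ^^ n) (T x))"
    by (simp add: funpow_swap1)
  also have "\<dots> = \<psi> x + (\<Sum>i<n. \<psi> ((T ^^ i) (T x)))"
    by (simp only: branches_word[OF Suc.prems] Suc.IH[OF \<Lambda>_invariant[OF Suc.prems]])
  also have "\<dots> = (\<Sum>i<Suc n. \<psi> ((T ^^ i) x))"
    unfolding sum.lessThan_Suc_shift by (simp add: funpow_swap1)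
  finally show ?case .
qed simp

lemma visits_word:
  "real (visits (word T letter n x)) = (\<Sum>i<n. indicat_real {y. letter y \<noteq> 0} ((T ^^ i) x))"
proof (induction n arbitrary: x)
  case (Suc n)
  have "real (visits (word T letter (Suc n) x))
      = indicat_real {y. letter y \<noteq> 0} x + real (visits (word T letter n (T x)))"
    by (simp add: visits_def indicator_def)
  also have "\<dots> = (\<Sum>i<Suc n. indicat_real {y. letter y \<noteq> 0} ((T ^^ i) x))"
    unfolding sum.lessThan_Suc_shift Suc by (simp add: funpow_swap1)
  finally show ?case .
qed (simp add: visits_def)

text \<open>Both points lie between the images of \<open>0\<close> and \<open>b\<close> under the
  inverse branches of their common word.\<close>

lemma same_word_close:
  assumes "x \<in> \<Lambda>" "y \<in> \<Lambda>" "word T letter k x = word T letter k y"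
  shows "\<bar>x - y\<bar> \<le> len (word T letter k x) 0 b"
proof -
  let ?w = "word T letter k x"
  have w: "set ?w \<subseteq> {..<d}" by (rule word_range[OF assms(1)])
  have iter: "(T ^^ k) z \<in> \<Lambda>" if "z \<in> \<Lambda>" for z
    using that by (induction k) (auto simp: \<Lambda>_invariant)
  have "branches ?w 0 \<le> z \<and> z \<le> branches ?w b" if "z \<in> \<Lambda>" "word T letter k z = ?w" for z
    using branches_mono[OF w, of 0 "(T ^^ k) z"] branches_mono[OF w, of "(T ^^ k) z" b]
      \<Lambda>_range[OF iter[OF that(1)]] branches_word[OF that(1), of k] that(2) by auto
  from this[OF assms(1)] this[OF assms(2)] show ?thesis using assms(3) by (auto simp: len_def)
qed

section \<open>The coding determines finite partitions\<close>

text \<open>Inner regularity of finite Borel measures. It is applied on the whole line, to the image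
  \<open>N\<close> of \<open>\<mu>\<close> under the inclusion.\<close>

lemma inner_compact:
  assumes "A \<in> sets \<mu>" "e > 0"
  obtains C where "C \<subseteq> A" "compact C" "C \<in> sets \<mu>" "measure \<mu> (A - C) \<le> e"
proof -
  define N where "N = distr \<mu> borel (\<lambda>x. x)"
  have A: "A \<in> sets borel" by (rule circle_sets_borel[OF sets_mu assms(1)])
  have sub: "A \<subseteq> space \<mu>" using assms(1) by (rule sets.sets_into_space)
  have N_eq: "emeasure N B = emeasure \<mu> B" if "B \<in> sets borel" "B \<subseteq> A" for B
    using that sub unfolding N_def by (subst emeasure_distr) (auto intro!: arg_cong[of _ _ "emeasure \<mu>"])
  have B_sets: "B \<in> sets \<mu>" if "B \<in> sets borel" "B \<subseteq> A" for B
    using that sub space_mu sets_mu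
    by (auto simp: circle_borel_def circle_space_def sets_restrict_space_iff)
  interpret N: prob_space N unfolding N_def by (rule prob_space_distr) simp
  show thesis
  proof (cases "measure \<mu> A \<le> e")
    case True
    then show thesis by (intro that[of "{}"]) auto
  next
    case False
    have "ennreal (measure \<mu> A - e) < ennreal (measure \<mu> A)"
      using False assms(2) by (intro ennreal_lessI) auto
    also have "ennreal (measure \<mu> A) = emeasure N A" using N_eq[OF A] by (simp add: emeasure_eq_measure)
    also have "emeasure N A = (SUP C \<in> {C. C \<subseteq> A \<and> compact C}. emeasure N C)"
      using N.emeasure_space_1 A by (intro inner_regular) (simp_all add: N_def)
    finally obtain C where C: "C \<subseteq> A" "compact C" "ennreal (measure \<mu> A - e) < emeasure N C"
      unfolding less_SUP_iff by auto
    have Cb: "C \<in> sets borel" using C(2) by (intro borel_closed compact_imp_closed)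
    then have "C \<in> sets \<mu>" using C B_sets by auto
    moreover have "measure \<mu> A - e < measure \<mu> C"
      using C(3) N_eq[OF Cb C(1)] False by (simp add: emeasure_eq_measure ennreal_less_iff)
    ultimately show thesis
      using C assms by (intro that[of C]) (auto simp: finite_measure_Diff)
  qed
qed

text \<open>Replace each atom by a compact subset of nearly full measure. These finitely many
  disjoint compact sets are a positive distance apart, so for large \<open>k\<close> a cylinder is
  too short to meet two of them within \<open>\<Lambda>\<close>, and the word identifies the
  atom.\<close>

lemma generating:
  assumes P: "fin_partition \<mu> P" and "e > 0"
  shows "\<exists>k pick bad. bad \<in> sets \<mu> \<and> measure \<mu> bad \<le> e \<and>
      (\<forall>v. pick v \<in> P) \<and> (\<forall>x\<in>\<Lambda> - bad. x \<in> pick (word T letter k x))"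
proof -
  interpret finite_partition_system \<mu> T P by unfold_locales (rule P)
  obtain A\<^sub>0 where A\<^sub>0: "A\<^sub>0 \<in> P" using P_cover not_empty by blast
  have cardP: "real (card P) > 0" using A\<^sub>0 finite_P by (auto simp: card_gt_0_iff)
  have "\<exists>C. C \<subseteq> A \<and> compact C \<and> C \<in> sets \<mu> \<and> measure \<mu> (A - C) \<le> e / real (card P)" if "A \<in> P" for A
    using inner_compact[of A "e / real (card P)"] P_sets[OF that] assms(2) cardP
    by (metis divide_pos_pos)
  then obtain C where C: "\<And>A. A \<in> P \<Longrightarrow> C A \<subseteq> A" "\<And>A. A \<in> P \<Longrightarrow> compact (C A)"
      "\<And>A. A \<in> P \<Longrightarrow> C A \<in> sets \<mu>" "\<And>A. A \<in> P \<Longrightarrow> measure \<mu> (A - C A) \<le> e / real (card P)"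
    by metis
  define bad where "bad = (\<Union>A\<in>P. A - C A)"
  have bad_sets: "bad \<in> sets \<mu>"
    unfolding bad_def using finite_P P_sets C(3) by (intro sets.finite_UN) auto
  have "measure \<mu> bad \<le> (\<Sum>A\<in>P. measure \<mu> (A - C A))"
    unfolding bad_def using finite_P P_sets C(3) by (intro finite_measure_subadditive_finite) auto
  also have "\<dots> \<le> (\<Sum>A\<in>P. e / real (card P))" by (intro sum_mono C(4))
  also have "\<dots> = e" using cardP by simp
  finally have bad_le: "measure \<mu> bad \<le> e" .
  have "\<exists>r>0. \<forall>x\<in>C A. \<forall>y\<in>C B. r \<le> dist x y" if "A \<in> P" "B \<in> P" "A \<noteq> B" for A B
  proof (rule separate_compact_closed)
    show "C A \<inter> C B = {}" using that C(1) P_disjoint by blast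
  qed (use that C(2) in \<open>auto intro: compact_imp_closed\<close>)
  then obtain r where r: "\<And>A B. A \<in> P \<Longrightarrow> B \<in> P \<Longrightarrow> A \<noteq> B \<Longrightarrow> r A B > 0 \<and> (\<forall>x\<in>C A. \<forall>y\<in>C B. r A B \<le> dist x y)"
    by metis
  \<comment> \<open>The inserted \<open>1\<close> keeps the set nonempty when \<open>P\<close> has a
    single atom.\<close>
  define \<delta> where "\<delta> = Min (insert 1 ((\<lambda>(A, B). r A B) ` {(A, B) \<in> P \<times> P. A \<noteq> B}))"
  have fin: "finite ((\<lambda>(A, B). r A B) ` {(A, B) \<in> P \<times> P. A \<noteq> B})"
    by (rule finite_imageI, rule finite_subset[of _ "P \<times> P"]) (use finite_P in auto)
  have \<delta>: "\<delta> > 0" unfolding \<delta>_def using fin r by (subst Min_gr_iff) auto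
  have \<delta>_le: "\<delta> \<le> r A B" if "A \<in> P" "B \<in> P" "A \<noteq> B" for A B
    unfolding \<delta>_def using fin that by (intro Min_le) auto
  have "\<delta> / 2 > 0" using \<delta> by simp
  from len_uniformly_small[OF this] obtain k
    where k: "\<And>w. set w \<subseteq> {..<d} \<Longrightarrow> length w \<ge> k \<Longrightarrow> len w 0 b \<le> \<delta> / 2" by blast
  define good where "good v A \<longleftrightarrow> A \<in> P \<and> (\<exists>x\<in>C A \<inter> \<Lambda>. word T letter k x = v)" for v A
  \<comment> \<open>Any atom whose compact part contains a point of \<open>\<Lambda>\<close> with
    word \<open>v\<close> will do; \<open>A\<^sub>0\<close> is a default for words that do not
    occur.\<close>
  define pick where "pick v = (if \<exists>A. good v A then SOME A. good v A else A\<^sub>0)" for v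
  have pick_P: "pick v \<in> P" for v
    using someI_ex[of "good v"] A\<^sub>0 by (auto simp: pick_def good_def)
  have "x \<in> pick (word T letter k x)" if x: "x \<in> \<Lambda> - bad" for x
  proof -
    let ?v = "word T letter k x"
    have "x \<in> space \<mu>" using x by (auto simp: \<Lambda>_def)
    then obtain A where A: "A \<in> P" "x \<in> A" using P_cover by blast
    then have xC: "x \<in> C A" using x by (auto simp: bad_def)
    then have "good ?v A" using A x by (auto simp: good_def)
    then have "good ?v (pick ?v)" using someI_ex[of "good ?v"] by (auto simp: pick_def)
    then obtain y where y: "pick ?v \<in> P" "y \<in> C (pick ?v)" "y \<in> \<Lambda>" "word T letter k y = ?v"
      by (auto simp: good_def)
    have "\<bar>x - y\<bar> \<le> len ?v 0 b" using x y by (intro same_word_close) auto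
    also have "\<dots> \<le> \<delta> / 2" using x by (intro k word_range) auto
    finally have "dist x y < \<delta>" using \<delta> by (simp add: dist_real_def)
    then have "A = pick ?v" using r[OF A(1) y(1)] \<delta>_le[OF A(1) y(1)] xC y(2) by force
    then show ?thesis using A by simp
  qed
  then show ?thesis using bad_sets bad_le pick_P by blast
qed

section \<open>The entropy gap and its consequence\<close>

lemma ln_F'_integrable: "integrable \<mu> (\<lambda>x. ln \<bar>F' x\<bar>)"
proof -
  have "compact (F' ` {0..b})" by (intro compact_continuous_image F'_cont) simp
  then obtain B where B: "\<And>x. x \<in> {0..b} \<Longrightarrow> F' x \<le> B"
    using bounded_has_Sup(1)[of "F' ` {0..b}"] compact_imp_bounded by blast
  show ?thesis
  proof (rule integrable_const_bound[of _ "ln B"])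
    show "AE x in \<mu>. norm (ln \<bar>F' x\<bar>) \<le> ln B"
      using \<Lambda>_AE
    proof eventually_elim
      case (elim x)
      then show ?case using B[of x] F'_ge_1[of x] \<Lambda>_range[of x] by auto
    qed
  qed measurable
qed

text \<open>The coding bound with weights \<open>m w\<close> and potential \<open>\<Phi>\<close>.
  The distortion estimate turns \<open>- ln (len w 0 b)\<close> into a Birkhoff sum of
  \<open>ln \<bar>F'\<bar>\<close> up to a sublinear error, and
  \<open>exp (\<kappa> * visits w)\<close> subtracts \<open>\<kappa>\<close> for every visit to
  \<open>Y\<close>.\<close>

lemma entropy_gap:
  obtains \<kappa> where "\<kappa> > 0"
    "ks_entropy \<mu> T \<le> ereal ((\<integral>x. ln \<bar>F' x\<bar> \<partial>\<mu>) - \<kappa> * measure \<mu> {x \<in> space \<mu>. letter x \<noteq> 0})"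
proof -
  obtain \<kappa> Z where \<kappa>: "\<kappa> > 0"
    and Z: "\<And>n. (\<Sum>w\<in>words {..<d} n. exp (\<kappa> * real (visits w)) * len w 0 b) \<le> Z"
    by (rule weighted_len_sum) blast
  define Y where "Y = {x \<in> space \<mu>. letter x \<noteq> 0}"
  have Y [measurable]: "Y \<in> sets \<mu>" unfolding Y_def by measurable
  define m where "m w = exp (\<kappa> * real (visits w)) * len w 0 b" for w
  define \<Phi> where "\<Phi> x = ln \<bar>F' x\<bar> - \<kappa> * indicat_real Y x" for x
  have Y_int: "integrable \<mu> (\<lambda>x. \<kappa> * indicat_real Y x)"
    by (intro integrable_mult_right integrable_real_indicator) (auto simp: emeasure_eq_measure)
  have \<Phi>_int: "integrable \<mu> \<Phi>"
    unfolding \<Phi>_def using ln_F'_integrable Y_int by simp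
  have \<Phi>_eq: "(\<integral>x. \<Phi> x \<partial>\<mu>) = (\<integral>x. ln \<bar>F' x\<bar> \<partial>\<mu>) - \<kappa> * measure \<mu> Y"
    unfolding \<Phi>_def using ln_F'_integrable Y_int sets.sets_into_space[OF Y] by (simp add: Int_absorb2)
  have iter: "(T ^^ i) x \<in> \<Lambda>" if "x \<in> \<Lambda>" for i x
    using that by (induction i) (auto simp: \<Lambda>_invariant)
  have weight: "\<exists>C. \<forall>n. \<forall>x\<in>\<Lambda>.
      - ln (m (word T letter n x)) \<le> (\<Sum>i<n. \<Phi> ((T ^^ i) x)) + C + e * real n" if "e > 0" for e
  proof -
    have "e / K > 0" using that K(1) by simp
    from total_len_sublinear[OF this] obtain C where
      C: "\<And>w. set w \<subseteq> {..<d} \<Longrightarrow> total_len w 0 b \<le> C + e / K * real (length w)" by blast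
    have "- ln (m (word T letter n x)) \<le> (\<Sum>i<n. \<Phi> ((T ^^ i) x)) + (K * C - ln b) + e * real n"
      if x: "x \<in> \<Lambda>" for n x
    proof -
      let ?w = "word T letter n x"
      have w: "set ?w \<subseteq> {..<d}" by (rule word_range[OF x])
      have pos: "len ?w 0 b > 0" using len_pos[OF w] b by simp
      have "\<bar>ln (len ?w 0 b) - ln (b - 0) + birkhoff ?w ((T ^^ n) x)\<bar> \<le> K * total_len ?w 0 b"
        using b \<Lambda>_range[OF iter[OF x, of n]] by (intro ln_len_distortion[OF w]) auto
      moreover have "K * total_len ?w 0 b \<le> K * (C + e / K * real n)"
        using C[OF w] K(1) by (intro mult_left_mono) auto
      moreover have "K * (C + e / K * real n) = K * C + e * real n"
        using K(1) by (simp add: algebra_simps)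
      moreover have "(\<Sum>i<n. \<Phi> ((T ^^ i) x)) = birkhoff ?w ((T ^^ n) x) - \<kappa> * real (visits ?w)"
      proof -
        have "\<Phi> ((T ^^ i) x) = \<psi> ((T ^^ i) x) - \<kappa> * indicat_real {y. letter y \<noteq> 0} ((T ^^ i) x)" for i
          using F'_ge_1[of "(T ^^ i) x"] \<Lambda>_range[OF iter[OF x, of i]] iter[OF x, of i]
          by (auto simp: \<Phi>_def \<psi>_def Y_def \<Lambda>_def indicator_def)
        then show ?thesis
          by (simp only: birkhoff_word[OF x] visits_word sum_subtractf sum_distrib_left)
      qed
      moreover have "ln (m ?w) = \<kappa> * real (visits ?w) + ln (len ?w 0 b)"
        using pos by (simp add: m_def ln_mult)
      ultimately show ?thesis by (simp add: abs_le_iff)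
    qed
    then show ?thesis by blast
  qed
  have "entropy_wrt_partition \<mu> T P \<le> (\<integral>x. \<Phi> x \<partial>\<mu>)" if P: "fin_partition \<mu> P" for P
  proof -
    interpret finite_partition_system \<mu> T P by unfold_locales (rule P)
    show ?thesis
    proof (rule entropy_wrt_partition_le[OF \<Lambda>_sets \<Lambda>_AE \<Lambda>_invariant letter_measurable F_split(1) _ _ \<Phi>_int weight])
      show "m w > 0" if "set w \<subseteq> {..<d}" for w
        using len_pos[OF that, of 0 b] b by (simp add: m_def)
      show "sum m (words {..<d} n) \<le> Z" for n
        using Z[of n] by (simp add: m_def)
    qed (use generating[OF P] in auto)
  qed
  then have "ks_entropy \<mu> T \<le> ereal (\<integral>x. \<Phi> x \<partial>\<mu>)"
    unfolding ks_entropy_def by (intro SUP_least) auto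
  then show thesis using \<kappa> \<Phi>_eq that[of \<kappa>] by (simp add: Y_def)
qed

text \<open>The gap forces letter 0 almost surely. There \<open>T\<close> agrees with
  \<open>F\<close>, which moves every positive point of \<open>[0, b]\<close> to the right, so
  \<open>AE_eq_of_monotone\<close> for the identity leaves only the fixed point.\<close>

theorem entropy_formula_imp_AE_zero:
  assumes "ks_entropy \<mu> T = ereal (\<integral>x. ln \<bar>F' x\<bar> \<partial>\<mu>)"
  shows "AE x in \<mu>. x = 0"
proof -
  obtain \<kappa> where \<kappa>: "\<kappa> > 0"
    "ks_entropy \<mu> T \<le> ereal ((\<integral>x. ln \<bar>F' x\<bar> \<partial>\<mu>) - \<kappa> * measure \<mu> {x \<in> space \<mu>. letter x \<noteq> 0})"
    by (rule entropy_gap)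
  have "\<kappa> * measure \<mu> {x \<in> space \<mu>. letter x \<noteq> 0} \<le> 0" using \<kappa>(2) assms by simp
  then have "measure \<mu> {x \<in> space \<mu>. letter x \<noteq> 0} = 0"
    using \<kappa>(1) by (simp add: mult_le_0_iff measure_le_0_iff)
  moreover have "{x \<in> space \<mu>. letter x \<noteq> 0} \<in> sets \<mu>" by measurable
  ultimately have "AE x in \<mu>. letter x = 0"
    by (subst AE_iff_measurable[OF _ refl]) (auto simp: emeasure_eq_measure)
  then have TF: "AE x in \<mu>. x \<in> \<Lambda> \<and> T x = F x"
    using \<Lambda>_AE by eventually_elim (use F_split(2) in auto)
  have int: "integrable \<mu> (\<lambda>x. x)"
    using AE_space by (intro integrable_const_bound[of _ 1]) (auto simp: space_mu)
  have "AE x in \<mu>. x \<le> T x" using TF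
  proof eventually_elim
    case (elim x)
    then show ?case using F_gt_self[of x] F_0 \<Lambda>_range[of x] by (cases "x = 0") auto
  qed
  from AE_eq_of_monotone[OF int this] show ?thesis using TF
  proof eventually_elim
    case (elim x)
    then show ?case using F_gt_self[of x] \<Lambda>_range[of x] by (cases "x = 0") auto
  qed
qed

end

section \<open>The immediate basin of a saddle-node\<close>

locale saddle_node_lift =
  fixes F F' F'' :: "real \<Rightarrow> real" and d :: nat
  assumes F_deriv: "\<And>x. (F has_real_derivative F' x) (at x)"
    and F'_deriv: "\<And>x. (F' has_real_derivative F'' x) (at x)"
    and F''_cont: "continuous_on UNIV F''"
    and F'_pos: "\<And>x. F' x > 0"
    and F_0: "F 0 = 0" and F'_0: "F' 0 = 1" and F''_0: "F'' 0 > 0"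
    and F_shift: "\<And>x. F (x + 1) = F x + real d"
begin

lemma F_cont: "continuous_on S F"
  using F_deriv by (meson DERIV_continuous_on has_field_derivative_at_within)

lemma F_less: "x < y \<Longrightarrow> F x < F y"
  using DERIV_pos_imp_increasing[of x y F] F_deriv F'_pos by blast

lemma F_mono: "x \<le> y \<Longrightarrow> F x \<le> F y"
  using F_less[of x y] by (cases "x = y") auto

lemma d_pos: "d \<ge> 1"
  using F_less[of 0 1] F_shift[of 0] F_0 by simp

text \<open>\<open>F''\<close> is positive near 0, so \<open>F' < 1\<close> on the left and
  \<open>F' > 1\<close> on the right: \<open>F t - t\<close> has a strict local minimum at
  0.\<close>

lemma above_diagonal_near_zero:
  obtains \<delta> where "0 < \<delta>" "\<delta> < 1" "\<And>t. t \<noteq> 0 \<Longrightarrow> \<bar>t\<bar> < \<delta> \<Longrightarrow> F t > t"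
proof -
  have "isCont F'' 0" using F''_cont by (auto simp: continuous_on_eq_continuous_at)
  then obtain \<epsilon> where \<epsilon>: "\<epsilon> > 0" "\<forall>t. dist t 0 < \<epsilon> \<longrightarrow> dist (F'' t) (F'' 0) < F'' 0"
    using F''_0 unfolding continuous_at_eps_delta by blast
  have F''_pos: "F'' t > 0" if "\<bar>t\<bar> < \<epsilon>" for t
  proof -
    have "dist (F'' t) (F'' 0) < F'' 0" using \<epsilon>(2) that by (simp add: dist_real_def)
    then show ?thesis unfolding dist_real_def by linarith
  qed
  have F'_right: "F' z > 1" if z: "0 < z" "z < \<epsilon>" for z
  proof -
    obtain w where w: "0 < w" "w < z" "F' z - F' 0 = (z - 0) * F'' w"
      using MVT2[OF z(1) F'_deriv] by blast
    then have "(z - 0) * F'' w > 0" using that F''_pos[of w] by (intro mult_pos_pos) auto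
    then show ?thesis using w(3) F'_0 by linarith
  qed
  have F'_left: "F' z < 1" if z: "- \<epsilon> < z" "z < 0" for z
  proof -
    obtain w where w: "z < w" "w < 0" "F' 0 - F' z = (0 - z) * F'' w"
      using MVT2[OF z(2) F'_deriv] by blast
    then have "(0 - z) * F'' w > 0" using that F''_pos[of w] by (intro mult_pos_pos) auto
    then show ?thesis using w(3) F'_0 by linarith
  qed
  have "F t > t" if t: "t \<noteq> 0" "\<bar>t\<bar> < \<epsilon>" for t
  proof (cases "t > 0")
    case True
    obtain z where z: "0 < z" "z < t" "F t - F 0 = (t - 0) * F' z"
      using MVT2[OF True F_deriv] by blast
    have "t * 1 < t * F' z" using True F'_right[of z] z t by (intro mult_strict_left_mono) auto
    then show ?thesis using z(3) F_0 by simp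
  next
    case False
    then have "t < 0" using t by simp
    then obtain z where z: "t < z" "z < 0" "F 0 - F t = (0 - t) * F' z"
      using MVT2[OF \<open>t < 0\<close> F_deriv] by blast
    have "(- t) * F' z < (- t) * 1" using \<open>t < 0\<close> F'_left[of z] z t by (intro mult_strict_left_mono) auto
    then show ?thesis using z(3) F_0 by simp
  qed
  then show thesis using \<epsilon>(1) by (intro that[of "min \<epsilon> (1/2)"]) auto
qed

text \<open>\<open>F t - t\<close> is nonpositive at \<open>-1\<close> and positive just left of 0,
  so it has zeros between, and by compactness a largest one. A later point not above the diagonal
  would produce a larger zero. In degree one \<open>a = -1\<close> is possible.\<close>

lemma last_fixed_point:
  obtains a where "-1 \<le> a" "a < 0" "F a = a" "\<And>t. a < t \<Longrightarrow> t < 0 \<Longrightarrow> F t > t"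
proof -
  obtain \<delta> where \<delta>: "0 < \<delta>" "\<delta> < 1" and near: "\<And>t. t \<noteq> 0 \<Longrightarrow> \<bar>t\<bar> < \<delta> \<Longrightarrow> F t > t"
    by (rule above_diagonal_near_zero) blast
  \<comment> \<open>\<open>[s, 0)\<close> contains no fixed point, so the search can be restricted
    to the compact interval \<open>[-1, s]\<close>, away from the fixed point 0.\<close>
  define s where "s = - \<delta> / 2"
  have s: "-1 < s" "s < 0" "F s > s" using \<delta> near[of s] by (auto simp: s_def)
  define h where "h t = F t - t" for t
  have h_cont: "continuous_on S h" for S unfolding h_def by (intro continuous_intros F_cont)
  have "F (-1) = - real d" using F_shift[of "-1"] F_0 by simp
  then have h1: "h (-1) \<le> 0" using d_pos by (simp add: h_def)
  have fix_between: "\<exists>x\<ge>t. x \<le> s \<and> h x = 0" if "h t \<le> 0" "t \<le> s" for t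
    using that s(3) by (intro IVT' h_cont) (auto simp: h_def)
  let ?S = "{t \<in> {-1..s}. h t = 0}"
  have "compact ({-1..s} \<inter> h -` {0})"
    by (intro compact_Int_closed closed_vimage h_cont) auto
  then have "compact ?S" by (simp add: vimage_def Int_def)
  moreover have "?S \<noteq> {}" using fix_between[OF h1] s by auto
  ultimately obtain a where a: "a \<in> ?S" "\<And>t. t \<in> ?S \<Longrightarrow> t \<le> a"
    using compact_attains_sup[of ?S] by blast
  show thesis
  proof (rule that[of a])
    show "F t > t" if t: "a < t" "t < 0" for t
    proof (rule ccontr)
      assume not: "\<not> F t > t"
      have "t \<le> s"
      proof (rule ccontr)
        assume "\<not> t \<le> s"
        then show False using near[of t] t not \<delta> by (auto simp: s_def abs_if)
      qed
      then obtain x where "t \<le> x" "x \<le> s" "h x = 0" using fix_between[of t] not by (auto simp: h_def)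
      then show False using a(2)[of x] t a(1) by auto
    qed
  qed (use a s in \<open>auto simp: h_def\<close>)
qed

end

lemma circle_norm_ge:
  assumes "0 < p" "p \<le> x" "x \<le> q" "q < 1"
  shows "circle_norm x \<ge> min p (1 - q)"
proof -
  have "frac x = x" using assms by (simp add: frac_eq)
  then show ?thesis using assms by (auto simp: circle_norm_def)
qed

lemma not_tendsto_0_of_eventually_ge:
  fixes u :: "nat \<Rightarrow> real"
  assumes "e > 0" "\<And>k. k \<ge> N \<Longrightarrow> u k \<ge> e"
  shows "\<not> u \<longlonglongrightarrow> 0"
proof
  assume "u \<longlonglongrightarrow> 0"
  then have "e \<le> 0" using assms(2) by (intro LIMSEQ_le_const[of u 0 e]) auto
  then show False using assms(1) by simp
qed

section \<open>The immediate basin\<close>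

locale saddle_node_circle_map = saddle_node_lift +
  fixes T :: "real \<Rightarrow> real" and a :: real
  assumes T_def: "T = (\<lambda>t. frac (F t))"
    and a: "-1 < a" "a < 0" "F a = a"
begin

definition b :: real where "b = a + 1"

text \<open>The basin is lifted to the line, so that connected subsets are intervals and the order
  of the line can be used.\<close>

definition basin :: "real set" where
  "basin = {y. (\<lambda>k. circle_norm ((T ^^ k) (frac y))) \<longlonglongrightarrow> 0}"

lemma b: "0 < b" "b < 1" "F b = b + real d - 1"
  using a F_shift[of a] by (auto simp: b_def)

lemma T_b: "T b = b"
proof -
  have "frac (b + real_of_int (int d - 1)) = frac b" by (simp add: frac_def)
  moreover have "b + real_of_int (int d - 1) = F b" using b(3) by simp
  ultimately have "frac (F b) = frac b" by simp
  then show ?thesis using b(1,2) by (simp add: T_def frac_eq)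
qed

lemma eventually_fixed_not_basin:
  assumes p: "0 < p" "p < 1" "T p = p" and "(T ^^ k) (frac y) = p"
  shows "y \<notin> basin"
proof -
  have fix_p: "(T ^^ j) p = p" for j by (induction j) (auto simp: p)
  have "(T ^^ n) (frac y) = p" if "n \<ge> k" for n
  proof -
    have "(T ^^ n) (frac y) = (T ^^ (n - k)) ((T ^^ k) (frac y))"
      using that by (simp flip: funpow_add[THEN fun_cong, unfolded o_apply])
    then show ?thesis using assms fix_p by simp
  qed
  then have "circle_norm ((T ^^ n) (frac y)) \<ge> min p (1 - p)" if "n \<ge> k" for n
    using circle_norm_ge[of p p p] p that by simp
  then show ?thesis
    using not_tendsto_0_of_eventually_ge[of "min p (1 - p)" k] p by (auto simp: basin_def)
qed

text \<open>As long as the orbit of the lift stays in \<open>[0, 1)\<close>, taking fractional parts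
  changes nothing.\<close>

lemma T_orbit_eq:
  assumes "0 \<le> z" "\<And>i. i \<le> k \<Longrightarrow> (F ^^ i) z < 1"
  shows "(T ^^ k) z = (F ^^ k) z \<and> 0 \<le> (F ^^ k) z"
  using assms(2)
proof (induction k)
  case (Suc k)
  have IH: "(T ^^ k) z = (F ^^ k) z" "0 \<le> (F ^^ k) z" using Suc by auto
  have "0 \<le> F ((F ^^ k) z)" using F_mono[OF IH(2)] F_0 by simp
  moreover have "F ((F ^^ k) z) < 1" using Suc.prems[of "Suc k"] by simp
  ultimately show ?case using IH by (simp add: T_def frac_eq)
qed (use assms in simp)

lemma funpow_F_mono: "x \<le> y \<Longrightarrow> (F ^^ k) x \<le> (F ^^ k) y"
  by (induction k) (auto intro: F_mono)

lemma funpow_F_cont: "continuous_on S (F ^^ k)"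
proof (induction k)
  case (Suc k)
  then show ?case using continuous_on_compose[OF Suc F_cont] by simp
qed (simp add: id_def)

text \<open>If \<open>F x < x\<close>, there is a fixed point in \<open>(0, x]\<close>. Otherwise
  the orbit of \<open>x\<close> under \<open>F\<close> stays above \<open>x\<close>. Either it stays
  below \<open>b\<close>, hence at a positive distance from 0 on the circle, or it passes
  \<open>b\<close>, and then some point of \<open>[0, x]\<close> lands exactly on the fixed point
  \<open>b\<close>.\<close>

lemma right_side_leaves_basin:
  assumes x: "0 < x" "x < b"
  shows "\<not> {0..x} \<subseteq> basin"
proof
  assume sub: "{0..x} \<subseteq> basin"
  have Fx: "x \<le> F x"
  proof (rule ccontr)
    assume not: "\<not> x \<le> F x"
    obtain \<delta> where \<delta>: "0 < \<delta>" "\<delta> < 1" and near: "\<And>t. t \<noteq> 0 \<Longrightarrow> \<bar>t\<bar> < \<delta> \<Longrightarrow> F t > t"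
      by (rule above_diagonal_near_zero) blast
    define s where "s = min x (\<delta> / 2)"
    have s: "0 < s" "s \<le> x" "F s > s" using x \<delta> near[of s] by (auto simp: s_def)
    have "\<exists>p\<ge>s. p \<le> x \<and> F p - p = 0"
      using s not by (intro IVT2') (auto intro!: continuous_intros F_cont)
    then obtain p where p: "s \<le> p" "p \<le> x" "F p = p" by auto
    then have p1: "0 < p" "p < 1" using s x b by auto
    then have "p \<notin> basin"
      using p by (intro eventually_fixed_not_basin[of p 0]) (auto simp: T_def frac_eq)
    moreover have "p \<in> {0..x}" using p p1 by simp
    ultimately show False using sub by blast
  qed
  have x_le: "x \<le> (F ^^ k) x" for k
  proof (induction k)
    case (Suc k)
    then show ?case using F_mono[OF Suc] Fx by simp
  qed simp
  show False
  proof (cases "\<exists>k. b \<le> (F ^^ k) x")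
    case False
    then have lt: "(F ^^ k) x < b" for k by (simp add: not_le)
    have "(T ^^ k) x = (F ^^ k) x" for k
      using T_orbit_eq[of x k] x b lt by (meson less_imp_le less_trans)
    then have "circle_norm ((T ^^ k) (frac x)) \<ge> min x (1 - b)" for k
      using circle_norm_ge[of x "(F ^^ k) x" b] x b x_le[of k] lt[of k] by (simp add: frac_eq)
    then have "x \<notin> basin"
      using not_tendsto_0_of_eventually_ge[of "min x (1 - b)" 0] x b by (auto simp: basin_def)
    moreover have "x \<in> {0..x}" using x by simp
    ultimately show False using sub by blast
  next
    case True
    \<comment> \<open>The first passage time: all earlier iterates stay below \<open>b < 1\<close>,
      so the orbit of \<open>z\<close> under \<open>T\<close> is still that of the lift.\<close>
    define k where "k = (LEAST k. b \<le> (F ^^ k) x)"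
    have k: "b \<le> (F ^^ k) x" unfolding k_def using True by (rule LeastI_ex)
    have before: "(F ^^ i) x < b" if "i < k" for i
      using not_less_Least[of i "\<lambda>k. b \<le> (F ^^ k) x"] that by (simp add: k_def)
    have "(F ^^ k) 0 = 0" by (induction k) (auto simp: F_0)
    then obtain z where z: "0 \<le> z" "z \<le> x" "(F ^^ k) z = b"
      using IVT'[of "F ^^ k" 0 b x] k x b funpow_F_cont by auto
    have "(F ^^ i) z < 1" if "i \<le> k" for i
      using before[of i] funpow_F_mono[OF z(2), of i] b z(3) that by (cases "i = k") auto
    then have "(T ^^ k) z = b" using T_orbit_eq[OF z(1)] z(3) by simp
    then have "z \<notin> basin"
      using b z x by (intro eventually_fixed_not_basin[OF _ _ T_b, of k]) (auto simp: frac_eq)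
    moreover have "z \<in> {0..x}" using z by simp
    ultimately show False using sub by blast
  qed
qed

text \<open>The points \<open>a\<close> and \<open>b\<close> represent one fixed point outside the
  basin, so the component of 0 lies in \<open>(a, b)\<close>. Its positive points are excluded by
  the preceding lemma, and its negative points project into \<open>(b, 1)\<close>.\<close>

lemma not_in_immediate_basin:
  assumes x: "0 < x" "x \<le> b"
  shows "x \<notin> frac ` connected_component_set basin 0"
proof
  assume "x \<in> frac ` connected_component_set basin 0"
  then obtain y where y: "x = frac y" "connected_component basin 0 y" by auto
  then obtain C where C: "connected C" "C \<subseteq> basin" "0 \<in> C" "y \<in> C"
    unfolding connected_component_def by blast
  have "frac b = b" using b by (simp add: frac_eq)
  moreover have "frac a = b" using a by (simp add: b_def frac_unique_iff)
  ultimately have nb: "a \<notin> basin" "b \<notin> basin"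
    using eventually_fixed_not_basin[OF b(1,2) T_b, of 0] by auto
  show False
  proof (cases "y \<ge> 0")
    case True
    have sub: "{0..y} \<subseteq> basin" using connected_contains_Icc[OF C(1,3,4)] C(2) by blast
    then have "y < b" using nb b True by (meson atLeastAtMost_iff less_imp_le not_le subsetD)
    then have "x = y" using y(1) True b by (simp add: frac_eq)
    then show False using right_side_leaves_basin[of x] sub x \<open>y < b\<close> by auto
  next
    case False
    have "{y..0} \<subseteq> basin" using connected_contains_Icc[OF C(1,4,3)] C(2) by blast
    then have "a < y" using nb a by (meson atLeastAtMost_iff less_imp_le not_le subsetD)
    then have "frac y = y + 1" using False a by (simp add: frac_unique_iff)
    then show False using \<open>a < y\<close> x y(1) by (simp add: b_def)
  qed
qed

end

section \<open>From the lift to the Dirac mass\<close>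

lemma eq_return_of_AE_zero:
  assumes "prob_space \<mu>" "sets \<mu> = sets circle_borel" "AE x in \<mu>. x = 0"
  shows "\<mu> = return circle_borel 0"
proof (rule measure_eqI)
  interpret prob_space \<mu> by fact
  show "sets \<mu> = sets (return circle_borel 0)" using assms by simp
  fix A assume A: "A \<in> sets \<mu>"
  show "emeasure \<mu> A = emeasure (return circle_borel 0) A"
  proof (cases "0 \<in> A")
    case True
    then have "AE x in \<mu>. x \<in> A" using assms(3) by auto
    then have "emeasure \<mu> A = 1" using A emeasure_eq_1_AE by blast
    then show ?thesis using True A assms(2) by simp
  next
    case False
    then have "AE x in \<mu>. x \<notin> A" using assms(3) by auto
    then have "emeasure \<mu> A = 0"
      using A AE_iff_measurable[of A \<mu> "\<lambda>x. x \<notin> A"] sets.sets_into_space[OF A] by auto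
    then show ?thesis using False A assms(2) by simp
  qed
qed

theorem theoremB:
  fixes F F' F'' :: "real \<Rightarrow> real" and \<mu> :: "real measure"
  assumes lift: "\<forall>x. F (x + 1) - F x \<in> \<int>"
    and F_deriv: "\<forall>x. (F has_real_derivative F' x) (at x)"
    and F'_deriv: "\<forall>x. (F' has_real_derivative F'' x) (at x)"
    and F''_cont: "continuous_on UNIV F''"
    and local_diffeo: "\<forall>x. F' x \<noteq> 0"
    and fix0: "F 0 \<in> \<int>"
    and deriv0: "F' 0 = 1"
    and second0: "F'' 0 > 0"
    and unique_sn: "\<forall>p\<in>circle_space. F p - p \<in> \<int> \<and> F' p = 1 \<and> F'' p \<noteq> 0 \<longrightarrow> p = 0"
    and expanding: "\<forall>x\<in>circle_space.
        x \<notin> frac ` connected_component_set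
               {y. (\<lambda>k. circle_norm (((\<lambda>t. frac (F t)) ^^ k) (frac y))) \<longlonglongrightarrow> 0} 0
        \<longrightarrow> \<bar>F' x\<bar> > 1"
    and prob: "prob_space \<mu>"
    and sets_mu: "sets \<mu> = sets circle_borel"
    and inv: "invariant_measure \<mu> (\<lambda>t. frac (F t))"
    and entropy_formula: "ks_entropy \<mu> (\<lambda>t. frac (F t)) = ereal (\<integral>x. ln \<bar>F' x\<bar> \<partial>\<mu>)"
  shows "\<mu> = return circle_borel 0"
proof -
  define T where "T = (\<lambda>t. frac (F t))"
  \<comment> \<open>Subtracting the integer \<open>F 0\<close> gives a lift of the same circle map
    that fixes 0.\<close>
  define G where "G t = F t - F 0" for t
  have T_G: "T = (\<lambda>t. frac (G t))"
  proof
    fix t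
    obtain n where "F 0 = of_int n" using fix0 by (auto elim: Ints_cases)
    then show "T t = frac (G t)" by (simp add: T_def G_def frac_def)
  qed
  have F'_cont: "continuous_on S F'" for S
    using F'_deriv by (meson DERIV_continuous_on has_field_derivative_at_within)
  have F_cont: "continuous_on S F" for S
    using F_deriv by (meson DERIV_continuous_on has_field_derivative_at_within)
  \<comment> \<open>A continuous derivative without zeros keeps the sign it has at 0, so the map
    preserves orientation.\<close>
  have F'_pos: "F' x > 0" for x
  proof (rule ccontr)
    assume "\<not> F' x > 0"
    then have le: "F' x \<le> 0" by simp
    have "\<exists>z. F' z = 0"
    proof (cases "x \<le> 0")
      case True
      then show ?thesis using IVT'[of F' x 0 0] le deriv0 F'_cont by auto
    next
      case False
      then show ?thesis using IVT2'[of F' x 0 0] le deriv0 F'_cont by auto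
    qed
    then show False using local_diffeo by blast
  qed
  \<comment> \<open>The degree is well defined: a continuous function with integer values on the
    line is constant.\<close>
  have "(\<lambda>x. F (x + 1) - F x) constant_on UNIV"
  proof (rule continuous_discrete_range_constant)
    show "continuous_on UNIV (\<lambda>x. F (x + 1) - F x)"
      by (intro continuous_intros continuous_on_compose2[OF F_cont[of UNIV]] F_cont) auto
    fix x :: real
    show "\<exists>e>0. \<forall>y. y \<in> UNIV \<and> F (y + 1) - F y \<noteq> F (x + 1) - F x \<longrightarrow>
        e \<le> norm (F (y + 1) - F y - (F (x + 1) - F x))"
    proof (intro exI[of _ 1] conjI allI impI)
      fix y assume ne: "y \<in> UNIV \<and> F (y + 1) - F y \<noteq> F (x + 1) - F x"
      have "F (y + 1) - F y - (F (x + 1) - F x) \<in> \<int>" 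
        using lift by (blast intro: Ints_diff)
      then show "1 \<le> norm (F (y + 1) - F y - (F (x + 1) - F x))"
        using ne Ints_nonzero_abs_ge1 by fastforce
    qed simp
  qed simp
  then obtain r where r: "\<And>x. F (x + 1) - F x = r" by (auto simp: constant_on_def)
  have "F 0 < F 1"
    using F_deriv F'_pos DERIV_pos_imp_increasing[of 0 1 F] by auto
  then have "r > 0" using r[of 0] by simp
  moreover have "r \<in> \<int>" using lift r by metis
  ultimately obtain d where d: "r = real d"
    by (metis Ints_cases of_int_0_less_iff zero_less_imp_eq_int of_int_of_nat_eq)
  interpret G: saddle_node_lift G F' F'' d
  proof
    show "(G has_real_derivative F' x) (at x)" for x
      unfolding G_def using F_deriv by (auto intro!: derivative_eq_intros)
    show "G (x + 1) = G x + real d" for x using r[of x] d by (simp add: G_def)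
  qed (use F'_deriv F''_cont F'_pos deriv0 second0 in \<open>auto simp: G_def\<close>)
  interpret measure_preserving_system \<mu> T
    using prob inv by (simp add: measure_preserving_system_def measure_preserving_system_axioms_def T_def)
  have entropy_T: "ks_entropy \<mu> T = ereal (\<integral>x. ln \<bar>F' x\<bar> \<partial>\<mu>)"
    using entropy_formula by (simp add: T_def)
  note space_mu = circle_sets_space[OF sets_mu]
  obtain a where a: "-1 \<le> a" "a < 0" "G a = a" and above: "\<And>t. a < t \<Longrightarrow> t < 0 \<Longrightarrow> G t > t"
    by (rule G.last_fixed_point) blast
  define b where "b = a + 1"
  have supp: "AE x in \<mu>. x \<le> b"
  proof -
    \<comment> \<open>On \<open>(b, 1)\<close> this is the position and elsewhere it is 0, so it
      never decreases along \<open>T\<close>. Equality almost everywhere is impossible on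
      \<open>(b, 1)\<close>, where \<open>T\<close> moves points strictly right.\<close>
    define g :: "real \<Rightarrow> real" where "g x = x * indicator {b<..<1} x" for x
    have g_range: "0 \<le> g x" "g x \<le> 1" for x using a by (auto simp: g_def indicator_def b_def)
    have T_above: "x < T x \<and> T x < 1" if x: "b < x" "x < 1" for x
    proof -
      \<comment> \<open>One period to the left, the point lies in \<open>(a, 0)\<close>, where the
        lift is above the diagonal and still negative.\<close>
      have *: "G (x - 1) > x - 1" "G (x - 1) < 0"
        using above[of "x - 1"] G.F_less[of "x - 1" 0] G.F_0 x by (auto simp: b_def)
      have "G x = G (x - 1) + real d" using G.F_shift[of "x - 1"] by simp
      then have "T x = frac (G (x - 1))" by (simp add: T_G frac_def)
      also have "\<dots> = G (x - 1) + 1" using * x a by (simp add: frac_unique_iff b_def)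
      finally show ?thesis using * by simp
    qed
    have "integrable \<mu> g"
    proof (rule integrable_const_bound[of _ 1])
      show "g \<in> borel_measurable \<mu>"
        unfolding g_def by (rule circle_borel_measurable[OF sets_mu]) measurable
    qed (use g_range in auto)
    moreover have "g x \<le> g (T x)" for x
      using T_above[of x] g_range[of "T x"] by (cases "x \<in> {b<..<1}") (auto simp: g_def)
    ultimately have "AE x in \<mu>. g (T x) = g x" by (intro AE_eq_of_monotone) auto
    then show ?thesis using AE_space
    proof eventually_elim
      case (elim x)
      show ?case
      proof (rule ccontr)
        assume "\<not> x \<le> b"
        then show False using T_above[of x] elim by (auto simp: g_def space_mu)
      qed
    qed
  qed
  have "AE x in \<mu>. x = 0"
  proof (cases "a = -1")
    \<comment> \<open>Here \<open>b = 0\<close>, so \<open>supp\<close> alone leaves only the point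
      0.\<close>
    case True
    show ?thesis using supp AE_space
      by eventually_elim (use True in \<open>auto simp: b_def space_mu\<close>)
  next
    case False
    interpret B: saddle_node_circle_map G F' F'' d T a
      using a False T_G by unfold_locales auto
    have b_eq: "B.b = b" by (simp add: B.b_def b_def)
    \<comment> \<open>Points of \<open>(0, b]\<close> lie outside the immediate basin, so the
      expansion hypothesis applies to them; positivity of \<open>F'\<close> removes the absolute
      value.\<close>
    have exp: "F' x > 1" if x: "0 < x" "x \<le> b" for x
    proof -
      have "x \<in> circle_space" using x B.b by (simp add: circle_space_def b_eq)
      moreover have "x \<notin> frac ` connected_component_set B.basin 0"
        using x by (intro B.not_in_immediate_basin) (auto simp: b_eq)
      ultimately have "\<bar>F' x\<bar> > 1"
        using expanding unfolding B.basin_def T_def[symmetric] by blast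
      then show ?thesis using F'_pos[of x] by simp
    qed
    interpret neutral_cantor_system G F' F'' b d \<mu> T
    proof unfold_locales
      show "0 < b" "b < 1" "G b = b + real d - 1" using B.b by (auto simp: b_eq)
    qed (use G.F_deriv F'_deriv F''_cont G.F_0 deriv0 second0 exp T_G sets_mu supp in auto)
    show ?thesis by (rule entropy_formula_imp_AE_zero[OF entropy_T])
  qed
  then show ?thesis by (rule eq_return_of_AE_zero[OF prob sets_mu])
qed

end
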